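(* Let $(G,\textsc{mw}_{w,F},\lambda,\gamma)$ be a stochastic matching model with reneging, with queue-length process $X=(X_t)_{t\ge0}$ and generator $\mathcal L$ on $\mathcal X$. Assume $\lambda\in\textsc{Ncond}(G,\gamma)$ and let $\pi$ be the unique invariant distribution of $X$. Let $\alpha>0$ be small enough that there exist $C',K>0$ such that $\mathcal L e^{\alpha\|x\|}\le -C'e^{\alpha\|x\|}$ for every $x\in\mathcal X$ with $\|x\|\ge K$. Then there exist constants $C>0$ and $0<\rho<1$ such that for all $x\in\mathcal X$ and all $t\ge0$, $$\|\mathbb P_x[X_t=\cdot\,]-\pi(\cdot)\|_{\mathrm{TV}}\le C\rho^t e^{\alpha\|x\|}.$$
   Context: Setting. $G=(V,E)$ is a finite, simple, undirected, connected graph; edges are written $\langle i,j\rangle$. For $A\subset V$, $E(A)=\{i\in V:\langle i,j\rangle\in E\text{ for some }j\in A\}$ and $E(i)=E(\{i\})$. An independent set is a nonempty $I\subset V$ such that $i,j\in I$ implies $\langle i,j\rangle\notin E$; $\mathbb I(A)$ is the set of independent sets contained in $A$. Arrival rates: $\lambda=(\lambda(i))_{i\in V}$ with $\lambda(i)>0$; $\lambda(A)=\sum_{i\in A}\lambda(i)$. Reneging rates: $\gamma=(\gamma(i))_{i\in V}$ with $\gamma(i)\ge0$; $R=\{i\in V:\gamma(i)>0\}$, $R^c=\{i\in V:\gamma(i)=0\}$. Rewards: $w=(w_{(j,i)})$, nonnegative numbers indexed by ordered pairs $(j,i)$ with $\langle i,j\rangle\in E$ (not assumed symmetric). Errors: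 $F=(F_{(j,i)})$ is a family of cumulative distribution functions, and $U_{(j,i)}$ ($\langle i,j\rangle\in E$) are mutually independent real random variables, $U_{(j,i)}$ having cdf $F_{(j,i)}$. State space: $\mathcal X=\{x\in\mathbb N_0^{V}:x(i)x(j)=0\text{ whenever }\langle i,j\rangle\in E\}$; $\mathrm{supp}(x)=\{i:x(i)>0\}$; $\delta_i$ is the $i$-th canonical vector; $\|x\|=(\sum_{i\in V}x(i)^2)^{1/2}$. Model $(G,\textsc{mw}_{w,F},\lambda,\gamma)$ (generalized Max-Weight policy): class-$i$ items arrive according to independent Poisson processes of rate $\lambda(i)$; each stored $i$-item independently reneges at rate $\gamma(i)$; an arriving $j$-item that finds no stored item with class in $E(j)$ is stored; otherwise it is immediately matched (both items leave) with a stored item whose class is chosen uniformly at random in $\arg\max_{i\in E(j):x(i)>0}\big([x(i)+U_{(j,i)}]^++w_{(j,i)}\big)$, where $x$ is the current queue-length vector and the errors $U_{(j,i)}$ are drawn afresh at each arrival, independently of everything else. For $j\in V$ and $i\in E(j)$, $\nu_{x,j}(i)$ denotes the probability that an arriving $j$-item in state $x$ is matched with an $i$-item. The queue-length process $X=(X_t)_{t\ge0}$ is the continuous-time Markov chain on $\mathcal X$ with generator $$\mathcal Lf(x)=\sum_{i\notin E(\mathrm{supp}(x))}\lambda(i)[f(x+\delta_i)-f(x)]+\sum_{i\in\mathrm{supp}(x)}\Big[\gamma(i)x(i)+\sum_{j\in E(i)}\lambda(j)\nu_{x,j}(i)\Big][f(x-\delta_i)-f(x)].$$ $\textsc{Ncond}(G,\gamma)=\{\lambda\in(0,\infty)^{|V|}:\lambda(I)<\lambda(E(I))\text{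 for any }I\in\mathbb I(R^c)\}$; when $\lambda\in\textsc{Ncond}(G,\gamma)$ the chain $X$ is positive recurrent, so $\pi$ exists and is unique. $\mathbb P_x$ is the law of the chain started from $X_0=x$, and $\|P-P'\|_{\mathrm{TV}}=\sup_{A\subset\mathcal X}|P(A)-P'(A)|$. *)

theory Defs
  imports "HOL-Probability.Probability"
begin

text \<open>
  The vertex set \<open>V\<close> is the universe of a finite type \<open>'v\<close>, and \<open>adj i j\<close> says that
  \<open>\<langle>i,j\<rangle>\<close> is an edge. Quantities indexed by the ordered pairs \<open>(j,i)\<close> are functions on
  \<open>'v \<times> 'v\<close>, of which only the values on \<open>ordered_edges adj\<close> matter; in such a pair
  the first component is the class of the arriving item.
\<close>

definition connected_simple_graph :: "('v::finite \<Rightarrow> 'v \<Rightarrow> bool) \<Rightarrow> bool" where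
  "connected_simple_graph adj \<longleftrightarrow> symp adj \<and> irreflp adj \<and> (\<forall>i j. adj\<^sup>*\<^sup>* i j)"

definition neighbours :: "('v::finite \<Rightarrow> 'v \<Rightarrow> bool) \<Rightarrow> 'v set \<Rightarrow> 'v set" where
  "neighbours adj A = {i. \<exists>j\<in>A. adj i j}"

definition ordered_edges :: "('v::finite \<Rightarrow> 'v \<Rightarrow> bool) \<Rightarrow> ('v \<times> 'v) set" where
  "ordered_edges adj = {(j, i). adj i j}"

definition independent_sets :: "('v::finite \<Rightarrow> 'v \<Rightarrow> bool) \<Rightarrow> 'v set \<Rightarrow> 'v set set" where
  "independent_sets adj A = {I. I \<subseteq> A \<and> I \<noteq> {} \<and> (\<forall>i\<in>I. \<forall>j\<in>I. \<not> adj i j)}"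

definition non_reneging :: "('v::finite \<Rightarrow> real) \<Rightarrow> 'v set" where
  "non_reneging \<gamma> = {i. \<gamma> i = 0}"

definition Ncond :: "('v::finite \<Rightarrow> 'v \<Rightarrow> bool) \<Rightarrow> ('v \<Rightarrow> real) \<Rightarrow> ('v \<Rightarrow> real) set" where
  "Ncond adj \<gamma> = {lam. (\<forall>i. lam i > 0) \<and>
     (\<forall>I\<in>independent_sets adj (non_reneging \<gamma>). sum lam I < sum lam (neighbours adj I))}"

definition cumulative_distribution_function :: "(real \<Rightarrow> real) \<Rightarrow> bool" where
  "cumulative_distribution_function F \<longleftrightarrow> (\<exists>M. real_distribution M \<and> F = cdf M)"

definition matching_model ::
  "('v::finite \<Rightarrow> 'v \<Rightarrow> bool) \<Rightarrow> ('v \<times> 'v \<Rightarrow> real) \<Rightarrow> ('v \<times> 'v \<Rightarrow> real \<Rightarrow> real)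
    \<Rightarrow> ('v \<Rightarrow> real) \<Rightarrow> ('v \<Rightarrow> real) \<Rightarrow> bool" where
  "matching_model adj w F lam \<gamma> \<longleftrightarrow>
     connected_simple_graph adj \<and>
     (\<forall>e\<in>ordered_edges adj. w e \<ge> 0) \<and>
     (\<forall>e\<in>ordered_edges adj. cumulative_distribution_function (F e)) \<and>
     (\<forall>i. lam i > 0) \<and> (\<forall>i. \<gamma> i \<ge> 0)"

definition queue_states :: "('v::finite \<Rightarrow> 'v \<Rightarrow> bool) \<Rightarrow> ('v \<Rightarrow> nat) set" where
  "queue_states adj = {x. \<forall>i j. adj i j \<longrightarrow> x i * x j = 0}"

definition supp :: "('v::finite \<Rightarrow> nat) \<Rightarrow> 'v set" where
  "supp x = {i. x i > 0}"

definition euclidean_norm :: "('v::finite \<Rightarrow> nat) \<Rightarrow> real" where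
  "euclidean_norm x = L2_set (\<lambda>i. real (x i)) UNIV"

text \<open>
  The joint law of the independent errors: \<open>interval_measure (F e)\<close> is the law on the reals
  whose cumulative distribution function is \<open>F e\<close>.
\<close>

definition error_law ::
  "('v::finite \<Rightarrow> 'v \<Rightarrow> bool) \<Rightarrow> ('v \<times> 'v \<Rightarrow> real \<Rightarrow> real) \<Rightarrow> ('v \<times> 'v \<Rightarrow> real) measure" where
  "error_law adj F = (\<Pi>\<^sub>M e\<in>ordered_edges adj. interval_measure (F e))"

definition best_matches ::
  "('v::finite \<Rightarrow> 'v \<Rightarrow> bool) \<Rightarrow> ('v \<times> 'v \<Rightarrow> real) \<Rightarrow> ('v \<times> 'v \<Rightarrow> real) \<Rightarrow> ('v \<Rightarrow> nat) \<Rightarrow> 'v \<Rightarrow> 'v set"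
  where
  "best_matches adj w u x j =
     {i. is_arg_max (\<lambda>i. max 0 (real (x i) + u (j, i)) + w (j, i))
                    (\<lambda>i. i \<in> neighbours adj {j} \<and> x i > 0) i}"

text \<open>
  Given the errors \<open>u\<close>, the uniform tie-breaking rule selects \<open>i\<close> with probability
  \<open>1 / card (best_matches adj w u x j)\<close> if \<open>i\<close> is a maximiser and \<open>0\<close> otherwise;
  averaging over \<open>u\<close> gives \<open>\<nu>\<^bsub>x,j\<^esub>(i)\<close>.
\<close>

definition match_prob ::
  "('v::finite \<Rightarrow> 'v \<Rightarrow> bool) \<Rightarrow> ('v \<times> 'v \<Rightarrow> real) \<Rightarrow> ('v \<times> 'v \<Rightarrow> real \<Rightarrow> real)
    \<Rightarrow> ('v \<Rightarrow> nat) \<Rightarrow> 'v \<Rightarrow> 'v \<Rightarrow> real" where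
  "match_prob adj w F x j i =
     (LINT u|error_law adj F.
        indicator (best_matches adj w u x j) i / real (card (best_matches adj w u x j)))"

definition queue_generator ::
  "('v::finite \<Rightarrow> 'v \<Rightarrow> bool) \<Rightarrow> ('v \<times> 'v \<Rightarrow> real) \<Rightarrow> ('v \<times> 'v \<Rightarrow> real \<Rightarrow> real)
    \<Rightarrow> ('v \<Rightarrow> real) \<Rightarrow> ('v \<Rightarrow> real) \<Rightarrow> (('v \<Rightarrow> nat) \<Rightarrow> real) \<Rightarrow> ('v \<Rightarrow> nat) \<Rightarrow> real" where
  "queue_generator adj w F lam \<gamma> f x =
     (\<Sum>i\<in>- neighbours adj (supp x). lam i * (f (x(i := x i + 1)) - f x)) +
     (\<Sum>i\<in>supp x.
        (\<gamma> i * real (x i) + (\<Sum>j\<in>neighbours adj {i}. lam j * match_prob adj w F x j i))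
          * (f (x(i := x i - 1)) - f x))"

text \<open>
  The family \<open>P x\<close> of laws and the process \<open>X\<close> form a continuous-time Markov chain on the
  countable set \<open>S\<close> with generator \<open>L\<close>: \<open>X\<close> starts from \<open>x\<close> under \<open>P x\<close>, it has the
  time-homogeneous Markov property with respect to its own past, and \<open>L\<close> is the right derivative
  at time \<open>0\<close> of its transition semigroup. Testing the latter on finitely supported functions
  amounts to prescribing all entries of the rate matrix (take indicators of single states).
  No explosion is possible, as \<open>X\<close> takes its values in \<open>S\<close> at all times. Path regularity
  is not required, since it does not affect the laws of the \<open>X t\<close>.
\<close>

definition past_events :: "'a set \<Rightarrow> 'w measure \<Rightarrow> (real \<Rightarrow> 'w \<Rightarrow> 'a) \<Rightarrow> real \<Rightarrow> 'w set set" where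
  "past_events S M X s =
     sigma_sets (space M) {X u -` B \<inter> space M | u B. 0 \<le> u \<and> u \<le> s \<and> B \<subseteq> S}"

definition continuous_time_markov_chain ::
  "'a set \<Rightarrow> (('a \<Rightarrow> real) \<Rightarrow> 'a \<Rightarrow> real) \<Rightarrow> ('a \<Rightarrow> 'w measure) \<Rightarrow> (real \<Rightarrow> 'w \<Rightarrow> 'a) \<Rightarrow> bool" where
  "continuous_time_markov_chain S L P X \<longleftrightarrow>
     (\<forall>x\<in>S. prob_space (P x)) \<and>
     (\<forall>x\<in>S. \<forall>t\<ge>0. X t \<in> measurable (P x) (count_space S)) \<and>
     (\<forall>x\<in>S. AE \<omega> in P x. X 0 \<omega> = x) \<and>
     (\<forall>x\<in>S. \<forall>s\<ge>0. \<forall>t\<ge>0. \<forall>A\<in>past_events S (P x) X s. \<forall>y\<in>S. \<forall>z\<in>S.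
        measure (P x) {\<omega>\<in>A. X s \<omega> = y \<and> X (s + t) \<omega> = z} =
        measure (P x) {\<omega>\<in>A. X s \<omega> = y} * measure (P y) {\<omega>\<in>space (P y). X t \<omega> = z}) \<and>
     (\<forall>x\<in>S. \<forall>f. finite {y. f y \<noteq> 0} \<longrightarrow>
        ((\<lambda>t. ((LINT \<omega>|P x. f (X t \<omega>)) - f x) / t) \<longlongrightarrow> L f x) (at_right 0))"

definition invariant_distribution ::
  "'a set \<Rightarrow> ('a \<Rightarrow> 'w measure) \<Rightarrow> (real \<Rightarrow> 'w \<Rightarrow> 'a) \<Rightarrow> 'a pmf \<Rightarrow> bool" where
  "invariant_distribution S P X \<pi> \<longleftrightarrow>
     set_pmf \<pi> \<subseteq> S \<and>
     (\<forall>t\<ge>0. \<forall>y\<in>S.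
        measure_pmf.expectation \<pi> (\<lambda>x. measure (P x) {\<omega>\<in>space (P x). X t \<omega> = y}) = pmf \<pi> y)"

definition tv_dist :: "'a set \<Rightarrow> 'a measure \<Rightarrow> 'a measure \<Rightarrow> real" where
  "tv_dist S \<mu> \<mu>' = (SUP A\<in>Pow S. \<bar>measure \<mu> A - measure \<mu>' A\<bar>)"

end

theory Submission
  imports Defs
begin

text \<open>
  Write \<open>p\<^sub>t\<close> for the transition kernels and \<open>V x = exp (\<alpha> * \<parallel>x\<parallel>)\<close>. For a bounded function \<open>\<phi>\<close>
  the map \<open>u t x = \<integral> \<phi> dp\<^sub>t(x)\<close> satisfies the backward equation, since only finitely many jumps
  leave each state and the rate matrix is conservative. As \<open>V\<close> has finite sublevel sets, a maximum
  principle compares \<open>u\<close>, for \<open>\<phi> \<le> V\<close>, with the supersolution built from \<open>V\<close> and the drift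
  condition; this gives \<open>p\<^sub>t V \<le> exp (- c * t) * V + b / c\<close> without using the forward equation,
  and also \<open>\<pi> V \<le> b / c\<close>. From every state the empty queue is reached with positive probability at
  time \<open>1\<close>, so it serves as an atom common to all states of a sublevel set, and Harris' theorem for
  the skeleton at integer times yields the exponential rate.
\<close>

section \<open>Harris' theorem for discrete kernels\<close>

lemma integrable_pmf_bounded:
  fixes f :: "'a \<Rightarrow> real"
  assumes "\<And>y. \<bar>f y\<bar> \<le> M"
  shows "integrable (measure_pmf p) f"
  using assms by (intro measure_pmf.integrable_const_bound[where B = M]) auto

lemma expectation_pmf_bounded:
  fixes f :: "'a \<Rightarrow> real"
  assumes "\<And>y. \<bar>f y\<bar> \<le> M"
  shows "\<bar>measure_pmf.expectation p f\<bar> \<le> M"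
proof -
  have "\<bar>measure_pmf.expectation p f\<bar> \<le> measure_pmf.expectation p (\<lambda>y. \<bar>f y\<bar>)"
    by (rule integral_abs_bound)
  also have "\<dots> \<le> measure_pmf.expectation p (\<lambda>_. M)"
    using assms integrable_pmf_bounded[of f M p] by (intro integral_mono) auto
  finally show ?thesis by simp
qed

lemma expectation_bind_pmf:
  fixes f :: "'a \<Rightarrow> real"
  assumes "\<And>y. \<bar>f y\<bar> \<le> M"
  shows "measure_pmf.expectation (bind_pmf p q) f =
    measure_pmf.expectation p (\<lambda>x. measure_pmf.expectation (q x) f)"
  unfolding measure_pmf_bind
  using assms measurable_measure_pmf[of q]
  by (intro integral_bind[where K = "count_space UNIV" and B = M and B' = 1])
    (auto simp: measure_pmf.emeasure_space_1 intro!: bounded_linear_intros)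

text \<open>Monotone convergence along the truncations \<open>min V n\<close>. It carries estimates
  over to an unbounded \<open>V\<close> from bounded test functions, to which the backward equation
  applies.\<close>

lemma integrable_pmf_truncated:
  fixes V :: "'a \<Rightarrow> real"
  assumes nonneg: "\<And>y. 0 \<le> V y"
    and bound: "\<And>n::nat. measure_pmf.expectation p (\<lambda>y. min (V y) n) \<le> B"
  shows "integrable (measure_pmf p) V" and "measure_pmf.expectation p V \<le> B"
proof -
  have int: "integrable (measure_pmf p) (\<lambda>y. min (V y) (real n))" for n
    using nonneg by (intro integrable_pmf_bounded[where M = n]) auto
  have inc: "incseq (\<lambda>n::nat. measure_pmf.expectation p (\<lambda>y. min (V y) n))"
    by (intro incseq_SucI integral_mono int) auto
  obtain L where L: "(\<lambda>n::nat. measure_pmf.expectation p (\<lambda>y. min (V y) n)) \<longlonglongrightarrow> L"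
    using incseq_convergent[OF inc] bound by blast
  have mono: "AE y in measure_pmf p. mono (\<lambda>n::nat. min (V y) (real n))"
    by (auto simp: mono_def)
  have lim: "(\<lambda>n::nat. min (V y) (real n)) \<longlonglongrightarrow> V y" for y
  proof (rule tendsto_eventually)
    obtain N :: nat where N: "V y \<le> N" using real_arch_simple by blast
    show "\<forall>\<^sub>F n::nat in sequentially. min (V y) (real n) = V y"
      using eventually_ge_at_top[of N] by eventually_elim (use N in \<open>auto simp: min_def\<close>)
  qed
  note convergence = int mono AE_I2[OF lim] L
  show "integrable (measure_pmf p) V"
    by (rule integrable_monotone_convergence[OF convergence]) auto
  have "measure_pmf.expectation p V = L"
    by (rule integral_monotone_convergence[OF convergence]) auto
  then show "measure_pmf.expectation p V \<le> B"
    using LIMSEQ_le_const2[OF L] bound by auto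
qed

text \<open>Only the mass at \<open>z\<close> is kept. This is how a minorization by a single atom
  enters the contraction estimate.\<close>

lemma expectation_pmf_ge_atom:
  fixes h :: "'a \<Rightarrow> real"
  assumes int: "integrable (measure_pmf p) h"
    and nonneg: "\<And>y. y \<in> set_pmf p \<Longrightarrow> 0 \<le> h y"
  shows "pmf p z * h z \<le> measure_pmf.expectation p h"
proof -
  have "pmf p z * h z = measure_pmf.expectation p (\<lambda>y. indicator {z} y * h z)"
    by (simp add: measure_pmf_single)
  also have "\<dots> \<le> measure_pmf.expectation p h"
  proof (rule integral_mono_AE)
    show "integrable (measure_pmf p) (\<lambda>y. indicator {z} y * h z)"
      by (rule integrable_pmf_bounded[where M = "\<bar>h z\<bar>"]) (auto simp: indicator_def)
  qed (use int nonneg in \<open>auto simp: AE_measure_pmf_iff indicator_def\<close>)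
  finally show ?thesis .
qed

text \<open>
  Hairer and Mattingly's form of Harris' theorem: the oscillation of a function, measured
  relative to \<open>2 + \<beta> V x + \<beta> V y\<close>, contracts for a small \<open>\<beta>\<close>.
\<close>

lemma harris_contraction:
  fixes \<kappa> :: "'a \<Rightarrow> 'a pmf" and V :: "'a \<Rightarrow> real"
  assumes closed: "\<And>x. x \<in> S \<Longrightarrow> set_pmf (\<kappa> x) \<subseteq> S"
    and V_nonneg: "\<And>x. 0 \<le> V x"
    and V_int: "\<And>x. x \<in> S \<Longrightarrow> integrable (measure_pmf (\<kappa> x)) V"
    and drift: "\<And>x. x \<in> S \<Longrightarrow> measure_pmf.expectation (\<kappa> x) V \<le> g * V x + b"
    and g: "0 \<le> g" "g < 1" and b: "0 \<le> b"
    and R: "2 * b < (1 - g) * R"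
    and z: "z \<in> S"
    and \<epsilon>: "0 < \<epsilon>" "\<epsilon> \<le> 1"
    and minor: "\<And>x. x \<in> S \<Longrightarrow> V x \<le> R \<Longrightarrow> \<epsilon> \<le> pmf (\<kappa> x) z"
  obtains a \<beta> where "0 < a" "a < 1" "0 < \<beta>"
    "\<And>\<phi> M D x y. \<lbrakk>\<And>u. \<bar>\<phi> u\<bar> \<le> M; 0 \<le> D;
       \<And>u v. u \<in> S \<Longrightarrow> v \<in> S \<Longrightarrow> \<bar>\<phi> u - \<phi> v\<bar> \<le> D * (2 + \<beta> * V u + \<beta> * V v);
       x \<in> S; y \<in> S\<rbrakk> \<Longrightarrow>
       \<bar>measure_pmf.expectation (\<kappa> x) \<phi> - measure_pmf.expectation (\<kappa> y) \<phi>\<bar>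
         \<le> a * D * (2 + \<beta> * V x + \<beta> * V y)"
proof -
  \<comment> \<open>Small enough that the drift constant costs
    \<open>2 * (\<beta> * b) \<le> \<epsilon>\<close>, at most half of the gain
    \<open>2 * \<epsilon>\<close> that the atom provides.\<close>
  define \<beta> where "\<beta> = \<epsilon> / (2 * (b + 1))"
  define gap where "gap = (1 - g) * R - 2 * b"
  \<comment> \<open>The bounds \<open>\<epsilon> / 2\<close> and \<open>1 - g\<close> serve the case
    \<open>near\<close>. The last one is what \<open>far\<close> requires at \<open>s = R\<close>,
    and \<open>\<eta> \<le> 1 - g\<close> extends it to larger \<open>s\<close>.\<close>
  define \<eta> where "\<eta> = min (min (\<epsilon> / 2) (1 - g)) (\<beta> * gap / (\<beta> * R + 2))"
  have \<beta>: "0 < \<beta>" "2 * (\<beta> * b) \<le> \<epsilon>"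
    using \<epsilon> b by (auto simp: \<beta>_def field_simps)
  have gap: "0 < gap" using R by (simp add: gap_def)
  have "0 < (1 - g) * R" using R b by linarith
  then have R_pos: "0 < R" using g by (simp add: zero_less_mult_iff)
  have denom: "0 < \<beta> * R + 2" using \<beta> R_pos by (simp add: add_pos_pos)
  have \<eta>: "0 < \<eta>" "\<eta> \<le> \<epsilon> / 2" "\<eta> \<le> 1 - g"
    using \<epsilon> g \<beta> gap denom unfolding \<eta>_def by (simp, linarith+)
  have \<eta>_half: "\<eta> \<le> 1 / 2" using \<eta> \<epsilon> by linarith
  have "\<eta> \<le> \<beta> * gap / (\<beta> * R + 2)" by (simp add: \<eta>_def)
  then have \<eta>_gap: "\<eta> * (\<beta> * R + 2) \<le> \<beta> * gap"
    using denom by (simp add: pos_le_divide_eq)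
  have far: "2 + 2 * (\<beta> * b) + \<beta> * g * s \<le> (1 - \<eta>) * (2 + \<beta> * s)" if "R \<le> s" for s
  proof -
    have "(1 - \<eta> - g) * \<beta> * R \<le> (1 - \<eta> - g) * \<beta> * s"
      using \<eta> \<beta> that by (intro mult_left_mono) auto
    then show ?thesis using \<eta>_gap by (simp add: gap_def algebra_simps)
  qed
  have near: "2 - 2 * \<epsilon> + 2 * (\<beta> * b) + \<beta> * g * s \<le> (1 - \<eta>) * (2 + \<beta> * s)" if "0 \<le> s" for s
  proof -
    have "g * (\<beta> * s) \<le> (1 - \<eta>) * (\<beta> * s)"
      using \<eta> \<beta> that by (intro mult_right_mono) auto
    then show ?thesis using \<eta> \<beta> by (simp add: algebra_simps)
  qed
  show thesis
  proof (rule that[of "1 - \<eta>" \<beta>])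
    show "0 < 1 - \<eta>" "1 - \<eta> < 1" "0 < \<beta>" using \<eta> \<eta>_half \<beta> by auto
    fix \<phi> :: "'a \<Rightarrow> real" and M D :: real and x y :: 'a
    assume bounded: "\<And>u. \<bar>\<phi> u\<bar> \<le> M" and D: "0 \<le> D"
      and osc: "\<And>u v. u \<in> S \<Longrightarrow> v \<in> S \<Longrightarrow> \<bar>\<phi> u - \<phi> v\<bar> \<le> D * (2 + \<beta> * V u + \<beta> * V v)"
      and xy: "x \<in> S" "y \<in> S"
    \<comment> \<open>The oscillation weight splits as \<open>W u + W v\<close>, so
      \<open>osc\<close> bounds the difference of \<open>\<phi>\<close> at \<open>u\<close> and
      \<open>v\<close> by a sum of one-point terms.\<close>
    define W where "W u = D * (1 + \<beta> * V u)" for u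
    have W_nonneg: "0 \<le> W u" for u
      using D \<beta> V_nonneg by (simp add: W_def)
    text \<open>A shift of \<open>\<phi>\<close> turns the oscillation bound into a bound on its absolute value.\<close>
    define c where "c = (INF u\<in>S. W u - \<phi> u)"
    have below: "bdd_below ((\<lambda>u. W u - \<phi> u) ` S)"
      using W_nonneg bounded by (intro bdd_belowI[of _ "- M"]) (auto simp: abs_le_iff, smt (verit))
    have c_upper: "\<phi> u + c \<le> W u" if "u \<in> S" for u
      using cINF_lower[OF below that] by (simp add: c_def)
    have c_lower: "- W u \<le> \<phi> u + c" if "u \<in> S" for u
    proof -
      have "- W u - \<phi> u \<le> c"
        unfolding c_def
      proof (rule cINF_greatest)
        fix v assume "v \<in> S"
        from osc[OF \<open>u \<in> S\<close> this] show "- W u - \<phi> u \<le> W v - \<phi> v"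
          by (simp add: W_def algebra_simps abs_le_iff)
      qed (use that in auto)
      then show ?thesis by simp
    qed
    have \<phi>_int: "integrable (measure_pmf p) \<phi>" for p
      using bounded by (rule integrable_pmf_bounded)
    have W_int: "integrable (measure_pmf (\<kappa> u)) W" if "u \<in> S" for u
      unfolding W_def using V_int[OF that] by auto
    have W_drift: "measure_pmf.expectation (\<kappa> u) W \<le> D * (1 + \<beta> * (g * V u + b))" if "u \<in> S" for u
    proof -
      have "measure_pmf.expectation (\<kappa> u) W = D * (1 + \<beta> * measure_pmf.expectation (\<kappa> u) V)"
        unfolding W_def using V_int[OF that] by simp
      then show ?thesis
        using drift[OF that] D \<beta> by (auto intro!: mult_left_mono)
    qed
    \<comment> \<open>The defect \<open>W - (\<phi> + c)\<close> is nonnegative on \<open>S\<close>,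
      which carries \<open>\<kappa> u\<close>, so its expectation is at least the contribution of
      the atom \<open>z\<close>. \<open>lower\<close> does the same with
      \<open>W + (\<phi> + c)\<close>.\<close>
    have upper: "measure_pmf.expectation (\<kappa> u) \<phi> + c + pmf (\<kappa> u) z * (W z - (\<phi> z + c))
        \<le> D * (1 + \<beta> * (g * V u + b))" if "u \<in> S" for u
    proof -
      have "pmf (\<kappa> u) z * (W z - (\<phi> z + c))
          \<le> measure_pmf.expectation (\<kappa> u) (\<lambda>v. W v - (\<phi> v + c))"
        using W_int[OF that] \<phi>_int c_upper closed[OF that]
        by (intro expectation_pmf_ge_atom) fastforce+
      also have "\<dots> = measure_pmf.expectation (\<kappa> u) W - (measure_pmf.expectation (\<kappa> u) \<phi> + c)"
        using W_int[OF that] \<phi>_int by simp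
      finally show ?thesis using W_drift[OF that] by simp
    qed
    have lower: "- D * (1 + \<beta> * (g * V u + b)) + pmf (\<kappa> u) z * (W z + (\<phi> z + c))
        \<le> measure_pmf.expectation (\<kappa> u) \<phi> + c" if "u \<in> S" for u
    proof -
      have "0 \<le> W v + (\<phi> v + c)" if "v \<in> S" for v using c_lower[OF that] by linarith
      then have "pmf (\<kappa> u) z * (W z + (\<phi> z + c))
          \<le> measure_pmf.expectation (\<kappa> u) (\<lambda>v. W v + (\<phi> v + c))"
        using W_int[OF that] \<phi>_int closed[OF that]
        by (intro expectation_pmf_ge_atom) auto
      also have "\<dots> = measure_pmf.expectation (\<kappa> u) W + (measure_pmf.expectation (\<kappa> u) \<phi> + c)"
        using W_int[OF that] \<phi>_int by simp
      finally show ?thesis using W_drift[OF that] by simp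
    qed
    have one_sided: "measure_pmf.expectation (\<kappa> u) \<phi> - measure_pmf.expectation (\<kappa> v) \<phi>
        \<le> (1 - \<eta>) * D * (2 + \<beta> * V u + \<beta> * V v)" if uv: "u \<in> S" "v \<in> S" for u v
    proof -
      define s where "s = V u + V v"
      have gaps: "0 \<le> W z - (\<phi> z + c)" "0 \<le> W z + (\<phi> z + c)"
        using c_upper[OF z] c_lower[OF z] by linarith+
      have sum: "measure_pmf.expectation (\<kappa> u) \<phi> - measure_pmf.expectation (\<kappa> v) \<phi>
          + pmf (\<kappa> u) z * (W z - (\<phi> z + c)) + pmf (\<kappa> v) z * (W z + (\<phi> z + c))
          \<le> D * (2 + 2 * (\<beta> * b) + \<beta> * g * s)"
        using upper[OF uv(1)] lower[OF uv(2)] by (simp add: s_def algebra_simps)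
      \<comment> \<open>For \<open>R \<le> s\<close> the drift alone contracts. Otherwise both
        states lie in the sublevel set, each kernel charges \<open>z\<close> with at least
        \<open>\<epsilon>\<close>, and the two defects at \<open>z\<close> add up to
        \<open>2 * W z \<ge> 2 * D\<close>: a gain of \<open>2 * \<epsilon> * D\<close>.\<close>
      have "measure_pmf.expectation (\<kappa> u) \<phi> - measure_pmf.expectation (\<kappa> v) \<phi>
          \<le> D * ((1 - \<eta>) * (2 + \<beta> * s))"
      proof (cases "R \<le> s")
        case True
        have "0 \<le> pmf (\<kappa> u) z * (W z - (\<phi> z + c))" "0 \<le> pmf (\<kappa> v) z * (W z + (\<phi> z + c))"
          using gaps by auto
        then show ?thesis
          using sum mult_left_mono[OF far[OF True] D] by linarith
      next
        case False
        then have "V u \<le> R" "V v \<le> R" using V_nonneg[of u] V_nonneg[of v] by (auto simp: s_def)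
        then have "\<epsilon> * (W z - (\<phi> z + c)) \<le> pmf (\<kappa> u) z * (W z - (\<phi> z + c))"
          "\<epsilon> * (W z + (\<phi> z + c)) \<le> pmf (\<kappa> v) z * (W z + (\<phi> z + c))"
          using gaps minor uv by (auto intro!: mult_right_mono)
        moreover have "\<epsilon> * D \<le> \<epsilon> * W z"
          using \<epsilon> D \<beta> V_nonneg[of z] by (auto intro!: mult_left_mono simp: W_def algebra_simps)
        ultimately have "measure_pmf.expectation (\<kappa> u) \<phi> - measure_pmf.expectation (\<kappa> v) \<phi>
            \<le> D * (2 - 2 * \<epsilon> + 2 * (\<beta> * b) + \<beta> * g * s)"
          using sum by (simp add: algebra_simps)
        moreover have "0 \<le> s" using V_nonneg by (simp add: s_def)
        ultimately show ?thesis
          using mult_left_mono[OF near[of s] D] by linarith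
      qed
      then show ?thesis by (simp add: s_def algebra_simps)
    qed
    show "\<bar>measure_pmf.expectation (\<kappa> x) \<phi> - measure_pmf.expectation (\<kappa> y) \<phi>\<bar>
        \<le> (1 - \<eta>) * D * (2 + \<beta> * V x + \<beta> * V y)"
      using one_sided[OF xy] one_sided[OF xy(2,1)] by (simp add: abs_le_iff algebra_simps)
  qed
qed

section \<open>Jump semigroups with unbounded rates\<close>

text \<open>Rates may grow without bound over \<open>S\<close>, so the infinitesimal data are local:
  finitely many labelled jumps per state, and the derivative at time zero on finitely supported
  functions. Distinct labels may share a target.\<close>

locale jump_semigroup =
  fixes S :: "'a set" and \<kappa> :: "real \<Rightarrow> 'a \<Rightarrow> 'a pmf"
    and J :: "'a \<Rightarrow> 'k set" and rate :: "'a \<Rightarrow> 'k \<Rightarrow> real" and target :: "'a \<Rightarrow> 'k \<Rightarrow> 'a"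
  assumes closed: "\<And>x t. x \<in> S \<Longrightarrow> 0 \<le> t \<Longrightarrow> set_pmf (\<kappa> t x) \<subseteq> S"
    and at_zero: "\<And>x. x \<in> S \<Longrightarrow> \<kappa> 0 x = return_pmf x"
    and semigroup: "\<And>x s t. x \<in> S \<Longrightarrow> 0 \<le> s \<Longrightarrow> 0 \<le> t \<Longrightarrow> \<kappa> (s + t) x = bind_pmf (\<kappa> s x) (\<kappa> t)"
    and finite_jumps: "\<And>x. x \<in> S \<Longrightarrow> finite (J x)"
    and rate_nonneg: "\<And>x k. x \<in> S \<Longrightarrow> k \<in> J x \<Longrightarrow> 0 \<le> rate x k"
    and target_closed: "\<And>x k. x \<in> S \<Longrightarrow> k \<in> J x \<Longrightarrow> target x k \<in> S"
    and right_derivative: "\<And>x f. x \<in> S \<Longrightarrow> finite {y. f y \<noteq> 0} \<Longrightarrow>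
      ((\<lambda>h. (measure_pmf.expectation (\<kappa> h x) f - f x) / h)
        \<longlongrightarrow> (\<Sum>k\<in>J x. rate x k * (f (target x k) - f x))) (at_right 0)"
begin

section \<open>The generator, continuity in time and the backward equation\<close>

definition gen :: "('a \<Rightarrow> real) \<Rightarrow> 'a \<Rightarrow> real" where
  "gen f x = (\<Sum>k\<in>J x. rate x k * (f (target x k) - f x))"

lemma transition_rate:
  assumes "x \<in> S" "finite A"
  shows "((\<lambda>h. (measure_pmf.prob (\<kappa> h x) A - indicator A x) / h) \<longlongrightarrow> gen (indicator A) x) (at_right 0)"
proof -
  have "finite {y. indicator A y \<noteq> (0::real)}"
    using assms(2) by (simp add: indicator_def)
  from right_derivative[OF assms(1) this] show ?thesis by (simp add: gen_def)
qed

text \<open>A finite derivative at time zero forces continuity there: the difference quotient for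
  \<open>{x}\<close> is multiplied by \<open>h\<close>.\<close>

lemma pmf_self_tendsto:
  assumes "x \<in> S"
  shows "((\<lambda>h. pmf (\<kappa> h x) x) \<longlongrightarrow> 1) (at_right 0)"
proof -
  have "((\<lambda>h. h * ((measure_pmf.prob (\<kappa> h x) {x} - indicator {x} x) / h) + 1)
      \<longlongrightarrow> 0 * gen (indicator {x}) x + 1) (at_right 0)"
    using transition_rate[OF assms, of "{x}"] by (intro tendsto_intros) auto
  moreover have "\<forall>\<^sub>F h in at_right 0.
      h * ((measure_pmf.prob (\<kappa> h x) {x} - indicator {x} x) / h) + 1 = pmf (\<kappa> h x) x"
    using eventually_at_right_less by eventually_elim (simp add: measure_pmf_single)
  ultimately show ?thesis
    by (rule Lim_transform_eventually[THEN tendsto_eq_rhs]) simp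
qed

lemma expectation_semigroup:
  fixes f :: "'a \<Rightarrow> real"
  assumes "x \<in> S" "0 \<le> s" "0 \<le> t" and "\<And>y. \<bar>f y\<bar> \<le> M"
  shows "measure_pmf.expectation (\<kappa> (s + t) x) f =
    measure_pmf.expectation (\<kappa> s x) (\<lambda>y. measure_pmf.expectation (\<kappa> t y) f)"
  using assms by (simp add: semigroup expectation_bind_pmf[of f M])

text \<open>
  No rate leads out of the finite set of possible targets, so the mass that has left it by
  time \<open>h\<close> is \<open>o(h)\<close>.
\<close>

lemma gen_tendsto:
  fixes g :: "real \<Rightarrow> 'a \<Rightarrow> real"
  assumes x: "x \<in> S"
    and bounded: "\<And>h y. \<bar>g h y\<bar> \<le> M"
    and lim: "\<And>y. y \<in> S \<Longrightarrow> ((\<lambda>h. g h y) \<longlongrightarrow> g' y) (at_right 0)"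
  shows "((\<lambda>h. (measure_pmf.expectation (\<kappa> h x) (g h) - g h x) / h) \<longlongrightarrow> gen g' x) (at_right 0)"
proof -
  define A where "A = insert x (target x ` J x)"
  define main where
    "main h = (\<Sum>y\<in>A - {x}. (g h y - g h x) * (measure_pmf.prob (\<kappa> h x) {y} / h))" for h
  have A: "finite A" "A \<subseteq> S"
    using finite_jumps[OF x] target_closed[OF x] x by (auto simp: A_def)
  have jumps: "((\<lambda>h. measure_pmf.prob (\<kappa> h x) {y} / h) \<longlongrightarrow> gen (indicator {y}) x) (at_right 0)"
    if "y \<noteq> x" for y
    using transition_rate[OF x, of "{y}"] that by simp
  \<comment> \<open>For \<open>y \<noteq> x\<close>, \<open>gen (indicator {y}) x\<close> is the
    total rate from \<open>x\<close> to \<open>y\<close>. The labels are regrouped by target; jumps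
    from \<open>x\<close> to itself contribute zero.\<close>
  have gen_g': "gen g' x = (\<Sum>y\<in>A - {x}. (g' y - g' x) * gen (indicator {y}) x)"
  proof -
    have "(\<Sum>y\<in>A - {x}. (g' y - g' x) * gen (indicator {y}) x)
        = (\<Sum>y\<in>A - {x}. \<Sum>k\<in>J x. rate x k * ((g' y - g' x) * indicator {y} (target x k)))"
      by (auto simp: gen_def sum_distrib_left intro!: sum.cong)
    also have "\<dots> = (\<Sum>k\<in>J x. \<Sum>y\<in>A - {x}. rate x k * ((g' y - g' x) * indicator {y} (target x k)))"
      by (rule sum.swap)
    also have "\<dots> = (\<Sum>k\<in>J x. rate x k * (g' (target x k) - g' x))"
    proof (rule sum.cong[OF refl])
      fix k assume "k \<in> J x"
      then have "target x k \<in> A" by (simp add: A_def)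
      have "(\<Sum>y\<in>A - {x}. rate x k * ((g' y - g' x) * indicator {y} (target x k)))
          = (\<Sum>y\<in>A - {x}. if y = target x k then rate x k * (g' y - g' x) else 0)"
        by (rule sum.cong) (auto simp: indicator_def)
      also have "\<dots> = rate x k * (g' (target x k) - g' x)"
        using A \<open>target x k \<in> A\<close> by (simp add: sum.delta)
      finally show "(\<Sum>y\<in>A - {x}. rate x k * ((g' y - g' x) * indicator {y} (target x k)))
          = rate x k * (g' (target x k) - g' x)" .
    qed
    finally show ?thesis by (simp add: gen_def)
  qed
  have "(main \<longlongrightarrow> gen g' x) (at_right 0)"
    unfolding main_def gen_g' using A x by (intro tendsto_intros jumps lim) auto
  moreover have "((\<lambda>h. (measure_pmf.expectation (\<kappa> h x) (g h) - g h x) / h - main h) \<longlongrightarrow> 0) (at_right 0)"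
  proof (rule Lim_null_comparison)
    \<comment> \<open>\<open>A\<close> contains \<open>x\<close> and all its targets, so
      \<open>indicator A\<close> does not change along any jump from \<open>x\<close>.\<close>
    have "gen (indicator A) x = 0" by (simp add: gen_def A_def)
    then have "((\<lambda>h. (measure_pmf.prob (\<kappa> h x) A - 1) / h) \<longlongrightarrow> 0) (at_right 0)"
      using transition_rate[OF x A(1)] by (simp add: A_def)
    then have "((\<lambda>h. - (2 * M) * ((measure_pmf.prob (\<kappa> h x) A - 1) / h)) \<longlongrightarrow> - (2 * M) * 0) (at_right 0)"
      by (intro tendsto_intros)
    then show "((\<lambda>h. - (2 * M) * ((measure_pmf.prob (\<kappa> h x) A - 1) / h)) \<longlongrightarrow> 0) (at_right 0)"
      by simp
    show "\<forall>\<^sub>F h in at_right 0. norm ((measure_pmf.expectation (\<kappa> h x) (g h) - g h x) / h - main h)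
        \<le> - (2 * M) * ((measure_pmf.prob (\<kappa> h x) A - 1) / h)"
      using eventually_at_right_less
    proof eventually_elim
      fix h :: real assume h: "0 < h"
      have diff: "\<bar>g h y - g h x\<bar> \<le> 2 * M" for y
        using bounded[of h y] bounded[of h x] by linarith
      have M: "0 \<le> M" using bounded[of h x] by linarith
      have int: "integrable (measure_pmf (\<kappa> h x)) (\<lambda>y. (g h y - g h x) * indicator B y)" for B
        using diff M by (intro integrable_pmf_bounded[where M = "2 * M"]) (auto simp: indicator_def)
      have "measure_pmf.expectation (\<kappa> h x) (g h) - g h x
          = measure_pmf.expectation (\<kappa> h x) (\<lambda>y. g h y - g h x)"
        using integrable_pmf_bounded[of "g h", OF bounded] by simp
      \<comment> \<open>The part on \<open>A\<close> is exactly \<open>h * main h\<close>, its term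
        at \<open>x\<close> being zero. The part off \<open>A\<close> is at most
        \<open>2 * M\<close> times the escape probability.\<close>
      also have "\<dots> = measure_pmf.expectation (\<kappa> h x)
          (\<lambda>y. (g h y - g h x) * indicator A y + (g h y - g h x) * indicator (- A) y)"
        by (rule Bochner_Integration.integral_cong) (auto simp: indicator_def)
      also have "\<dots> = measure_pmf.expectation (\<kappa> h x) (\<lambda>y. (g h y - g h x) * indicator A y)
          + measure_pmf.expectation (\<kappa> h x) (\<lambda>y. (g h y - g h x) * indicator (- A) y)"
        using int by simp
      also have "measure_pmf.expectation (\<kappa> h x) (\<lambda>y. (g h y - g h x) * indicator A y)
          = (\<Sum>y\<in>A - {x}. (g h y - g h x) * indicator A y * pmf (\<kappa> h x) y)"
        using A by (intro integral_measure_pmf_real) (auto simp: indicator_def)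
      also have "\<dots> = h * main h"
        using h by (auto simp: main_def sum_distrib_left measure_pmf_single intro!: sum.cong)
      finally have "(measure_pmf.expectation (\<kappa> h x) (g h) - g h x) / h - main h
          = measure_pmf.expectation (\<kappa> h x) (\<lambda>y. (g h y - g h x) * indicator (- A) y) / h"
        using h by (simp add: field_simps)
      moreover have "\<bar>measure_pmf.expectation (\<kappa> h x) (\<lambda>y. (g h y - g h x) * indicator (- A) y)\<bar>
          \<le> 2 * M * (1 - measure_pmf.prob (\<kappa> h x) A)"
      proof -
        have "\<bar>measure_pmf.expectation (\<kappa> h x) (\<lambda>y. (g h y - g h x) * indicator (- A) y)\<bar>
            \<le> measure_pmf.expectation (\<kappa> h x) (\<lambda>y. \<bar>(g h y - g h x) * indicator (- A) y\<bar>)"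
          by (rule integral_abs_bound)
        also have "\<dots> \<le> measure_pmf.expectation (\<kappa> h x) (\<lambda>y. 2 * M * indicator (- A) y)"
        proof (rule integral_mono)
          show "integrable (measure_pmf (\<kappa> h x)) (\<lambda>y. 2 * M * indicator (- A) y)"
            using M by (intro integrable_pmf_bounded[where M = "2 * M"]) (auto simp: indicator_def)
          show "integrable (measure_pmf (\<kappa> h x)) (\<lambda>y. \<bar>(g h y - g h x) * indicator (- A) y\<bar>)"
            using int by (rule integrable_abs)
        qed (use diff in \<open>auto simp: indicator_def\<close>)
        also have "\<dots> = 2 * M * (1 - measure_pmf.prob (\<kappa> h x) A)"
          using measure_pmf.prob_compl[of A "\<kappa> h x"] by (simp add: Compl_eq_Diff_UNIV)
        finally show ?thesis .
      qed
      ultimately show "norm ((measure_pmf.expectation (\<kappa> h x) (g h) - g h x) / h - main h)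
          \<le> - (2 * M) * ((measure_pmf.prob (\<kappa> h x) A - 1) / h)"
        using h by (simp add: field_simps)
    qed
  qed
  ultimately show ?thesis
    using tendsto_add by fastforce
qed

text \<open>The first \<open>t - s\<close> units of time are run before the kernel at time
  \<open>s\<close> is applied. The mass still at \<open>x\<close> then contributes no difference,
  the rest at most \<open>2 * M\<close>. The bound depends on \<open>t - s\<close> alone, hence
  gives continuity at every time.\<close>

lemma expectation_increment:
  fixes \<phi> :: "'a \<Rightarrow> real"
  assumes x: "x \<in> S" and "0 \<le> s" "s \<le> t" and bounded: "\<And>y. \<bar>\<phi> y\<bar> \<le> M"
  shows "\<bar>measure_pmf.expectation (\<kappa> t x) \<phi> - measure_pmf.expectation (\<kappa> s x) \<phi>\<bar>
    \<le> 2 * M * (1 - pmf (\<kappa> (t - s) x) x)"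
proof -
  define g where "g y = measure_pmf.expectation (\<kappa> s y) \<phi>" for y
  have g: "\<bar>g y\<bar> \<le> M" for y
    unfolding g_def using bounded by (rule expectation_pmf_bounded)
  have M: "0 \<le> M" using bounded[of x] by linarith
  have "measure_pmf.expectation (\<kappa> t x) \<phi> = measure_pmf.expectation (\<kappa> (t - s) x) g"
    using expectation_semigroup[OF x, of "t - s" s \<phi> M] assms
    by (simp add: g_def[abs_def])
  then have "\<bar>measure_pmf.expectation (\<kappa> t x) \<phi> - g x\<bar>
      = \<bar>measure_pmf.expectation (\<kappa> (t - s) x) (\<lambda>y. g y - g x)\<bar>"
    using integrable_pmf_bounded[of g, OF g] by simp
  also have "\<dots> \<le> measure_pmf.expectation (\<kappa> (t - s) x) (\<lambda>y. \<bar>g y - g x\<bar>)"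
    by (rule integral_abs_bound)
  also have "\<dots> \<le> measure_pmf.expectation (\<kappa> (t - s) x) (\<lambda>y. 2 * M * (1 - indicator {x} y))"
  proof (rule integral_mono)
    show "integrable (measure_pmf (\<kappa> (t - s) x)) (\<lambda>y. \<bar>g y - g x\<bar>)"
      using integrable_pmf_bounded[of g, OF g] by simp
    show "integrable (measure_pmf (\<kappa> (t - s) x)) (\<lambda>y. 2 * M * (1 - indicator {x} y))"
      using M by (intro integrable_pmf_bounded[where M = "2 * M"]) (auto simp: indicator_def)
    show "\<bar>g y - g x\<bar> \<le> 2 * M * (1 - indicator {x} y)" for y
      using g[of x] g[of y] by (auto simp: indicator_def)
  qed
  also have "\<dots> = 2 * M * (1 - pmf (\<kappa> (t - s) x) x)"
    using integrable_pmf_bounded[of "indicator {x}" 1 "\<kappa> (t - s) x"] by (simp add: measure_pmf_single)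
  finally show ?thesis by (simp add: g_def)
qed

lemma expectation_continuous:
  fixes \<phi> :: "'a \<Rightarrow> real"
  assumes x: "x \<in> S" and bounded: "\<And>y. \<bar>\<phi> y\<bar> \<le> M"
  shows "continuous_on {0..} (\<lambda>t. measure_pmf.expectation (\<kappa> t x) \<phi>)"
proof (rule continuous_onI)
  fix t e :: real assume t: "t \<in> {0..}" and e: "0 < e"
  define u where "u s = measure_pmf.expectation (\<kappa> s x) \<phi>" for s
  have "((\<lambda>h. 2 * M * (1 - pmf (\<kappa> h x) x)) \<longlongrightarrow> 2 * M * (1 - 1)) (at_right 0)"
    by (intro tendsto_intros pmf_self_tendsto x)
  then have "\<forall>\<^sub>F h in at_right 0. 2 * M * (1 - pmf (\<kappa> h x) x) < e"
    using e order_tendstoD(2) by fastforce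
  then obtain d where d: "0 < d" "\<And>h. 0 < h \<Longrightarrow> h < d \<Longrightarrow> 2 * M * (1 - pmf (\<kappa> h x) x) < e"
    by (auto simp: eventually_at_right_field)
  have close: "\<bar>u b - u a\<bar> < e" if "0 \<le> a" "a < b" "b - a < d" for a b
    using expectation_increment[OF x that(1) less_imp_le[OF that(2)], of \<phi> M] bounded d(2)[of "b - a"] that
    by (simp add: u_def)
  show "\<exists>d>0. \<forall>s\<in>{0..}. dist s t < d \<longrightarrow>
      dist (measure_pmf.expectation (\<kappa> s x) \<phi>) (measure_pmf.expectation (\<kappa> t x) \<phi>) \<le> e"
  proof (intro exI[of _ d] conjI ballI impI)
    fix s :: real assume s: "s \<in> {0..}" "dist s t < d"
    consider "s < t" | "s = t" | "t < s" by linarith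
    then have "dist (u s) (u t) \<le> e"
      using close[of s t] close[of t s] s t e by cases (auto simp: dist_real_def)
    then show "dist (measure_pmf.expectation (\<kappa> s x) \<phi>) (measure_pmf.expectation (\<kappa> t x) \<phi>) \<le> e"
      by (simp add: u_def)
  qed (rule d(1))
qed

text \<open>
  The backward equation is stated for the left derivative because that is the one whose sign
  is known at a minimum over a bounded time interval.
\<close>

lemma left_derivative:
  fixes \<phi> :: "'a \<Rightarrow> real"
  assumes x: "x \<in> S" and t: "0 < t" and bounded: "\<And>y. \<bar>\<phi> y\<bar> \<le> M"
  shows "((\<lambda>h. (measure_pmf.expectation (\<kappa> t x) \<phi> - measure_pmf.expectation (\<kappa> (t - h) x) \<phi>) / h)
    \<longlongrightarrow> gen (\<lambda>y. measure_pmf.expectation (\<kappa> t y) \<phi>) x) (at_right 0)"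
proof -
  \<comment> \<open>By the semigroup property, the quotient of \<open>gen_tendsto\<close> for this
    family is the left difference quotient at \<open>t\<close>. For this reason
    \<open>gen_tendsto\<close> lets the function vary with \<open>h\<close>.\<close>
  define g where "g h y = measure_pmf.expectation (\<kappa> (t - h) y) \<phi>" for h y
  have g: "\<bar>g h y\<bar> \<le> M" for h y
    unfolding g_def using bounded by (rule expectation_pmf_bounded)
  have lim: "((\<lambda>h. g h y) \<longlongrightarrow> measure_pmf.expectation (\<kappa> t y) \<phi>) (at_right 0)" if "y \<in> S" for y
  proof -
    have "isCont (\<lambda>t. measure_pmf.expectation (\<kappa> t y) \<phi>) t"
      using expectation_continuous[OF that, of \<phi> M] bounded t
      by (auto intro: continuous_on_interior)
    moreover have "((\<lambda>h. t - h) \<longlongrightarrow> t - 0) (at_right (0::real))"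
      by (intro tendsto_intros)
    ultimately show ?thesis
      unfolding g_def by (auto intro: isCont_tendsto_compose)
  qed
  have "\<forall>\<^sub>F h in at_right 0. (measure_pmf.expectation (\<kappa> h x) (g h) - g h x) / h
      = (measure_pmf.expectation (\<kappa> t x) \<phi> - measure_pmf.expectation (\<kappa> (t - h) x) \<phi>) / h"
  proof (rule eventually_at_rightI[OF _ t])
    fix h assume h: "h \<in> {0<..<t}"
    then show "(measure_pmf.expectation (\<kappa> h x) (g h) - g h x) / h
        = (measure_pmf.expectation (\<kappa> t x) \<phi> - measure_pmf.expectation (\<kappa> (t - h) x) \<phi>) / h"
      using expectation_semigroup[OF x, of h "t - h" \<phi> M] bounded by (simp add: g_def[abs_def])
  qed
  from filterlim_cong[OF refl refl this] show ?thesis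
    using gen_tendsto[where g = g and M = M and g' = "\<lambda>y. measure_pmf.expectation (\<kappa> t y) \<phi>", OF x g lim]
    by simp
qed

section \<open>Comparison of the semigroup and of its invariant law with a Lyapunov function\<close>

text \<open>Minimum principle: if the bound failed, a strict supersolution minus \<open>u\<close>
  would attain a negative minimum over time and states. There its left time derivative is at most
  zero while \<open>gen\<close> of it is at least zero, which the drift condition excludes.\<close>

lemma drift_bound:
  fixes \<phi> V :: "'a \<Rightarrow> real"
  assumes bounded: "\<And>y. \<bar>\<phi> y\<bar> \<le> M"
    and below: "\<And>y. y \<in> S \<Longrightarrow> \<phi> y \<le> V y"
    and sublevel: "\<And>m. finite {y \<in> S. V y \<le> m}"
    and V_nonneg: "\<And>y. 0 \<le> V y"
    and c: "0 < c" and b: "0 \<le> b"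
    and drift: "\<And>y. y \<in> S \<Longrightarrow> gen V y \<le> - c * V y + b"
    and T: "0 \<le> T" and x: "x \<in> S"
  shows "measure_pmf.expectation (\<kappa> T x) \<phi> \<le> exp (- c * T) * V x + b / c"
proof (rule ccontr)
  define u where "u t y = measure_pmf.expectation (\<kappa> t y) \<phi>" for t y
  \<comment> \<open>The factor \<open>1 - exp (- c * t)\<close> adds
    \<open>b * exp (- c * t)\<close> to the time derivative, matching the constant in the drift
    condition. At time zero \<open>W\<close> equals \<open>V\<close>, which dominates
    \<open>\<phi>\<close> on \<open>S\<close>.\<close>
  define W where "W t y = exp (- c * t) * V y + b / c * (1 - exp (- c * t))" for t y
  assume "\<not> ?thesis"
  then have "W T x < u T x"
    using b c by (simp add: W_def u_def algebra_simps) (smt (verit) divide_nonneg_pos exp_ge_zero mult_nonneg_nonneg)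
  text \<open>\<open>W\<close> is a supersolution; the term in \<open>\<delta>\<close> makes it a strict one.\<close>
  define \<delta> where "\<delta> = (u T x - W T x) / (2 * (1 + T))"
  define D where "D t y = W t y - u t y + \<delta> * (1 + t)" for t y
  have \<delta>: "0 < \<delta>" using T \<open>W T x < u T x\<close> by (simp add: \<delta>_def)
  have "\<delta> * (1 + T) = (u T x - W T x) / 2"
    using T by (simp add: \<delta>_def field_simps)
  then have D_neg: "D T x < 0" using \<open>W T x < u T x\<close> by (simp add: D_def)
  have u_le: "u t y \<le> M" for t y
    using expectation_pmf_bounded[of \<phi> M, OF bounded] by (simp add: u_def abs_le_iff)
  \<comment> \<open>As \<open>u \<le> M\<close>, \<open>D\<close> can be negative only where
    \<open>exp (- c * t) * V y < M\<close>; this finite sublevel set covers all times up to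
    \<open>T\<close>.\<close>
  define Y where "Y = {y \<in> S. V y \<le> exp (c * T) * M}"
  have Y: "finite Y" "Y \<subseteq> S" using sublevel by (auto simp: Y_def)
  have outside: "y \<in> Y" if "y \<in> S" "t \<in> {0..T}" "D t y < 0" for t y
  proof -
    have "0 \<le> b / c * (1 - exp (- c * t))" "0 \<le> \<delta> * (1 + t)"
      using b c \<delta> that by auto
    then have "exp (- c * t) * V y < M"
      using that u_le[of t y] unfolding D_def W_def by linarith
    moreover have "exp (- c * T) * V y \<le> exp (- c * t) * V y"
      using that c V_nonneg by (intro mult_right_mono) auto
    ultimately have "exp (c * T) * (exp (- c * T) * V y) \<le> exp (c * T) * M"
      by (intro mult_left_mono) auto
    then show ?thesis
      using that by (simp add: Y_def mult.assoc[symmetric] exp_add[symmetric])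
  qed
  have "x \<in> Y" using outside[OF x _ D_neg] T by simp
  have cont: "continuous_on {0..T} (\<lambda>t. D t y)" if "y \<in> S" for y
    unfolding D_def W_def u_def
    using continuous_on_subset[OF expectation_continuous[of y \<phi> M, OF that bounded]]
    by (intro continuous_intros) auto
  \<comment> \<open>Minimisation in time for each fixed state, by compactness; then over the finite
    set \<open>Y\<close>.\<close>
  have "\<exists>t\<in>{0..T}. \<forall>s\<in>{0..T}. D t y \<le> D s y" if "y \<in> S" for y
    using T by (intro continuous_attains_inf cont that) auto
  then obtain \<theta> where \<theta>: "\<And>y. y \<in> S \<Longrightarrow> \<theta> y \<in> {0..T}"
    "\<And>y s. y \<in> S \<Longrightarrow> s \<in> {0..T} \<Longrightarrow> D (\<theta> y) y \<le> D s y"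
    by metis
  obtain x0 where x0: "x0 \<in> Y" "\<And>y. y \<in> Y \<Longrightarrow> D (\<theta> x0) x0 \<le> D (\<theta> y) y"
    using ex_is_arg_min_if_finite[OF Y(1), of "\<lambda>y. D (\<theta> y) y"] \<open>x \<in> Y\<close>
    by (auto simp: is_arg_min_linorder)
  define t0 where "t0 = \<theta> x0"
  have x0_S: "x0 \<in> S" and t0: "t0 \<in> {0..T}"
    using x0 Y \<theta> by (auto simp: t0_def)
  have D0_neg: "D t0 x0 < 0"
    using x0(2)[OF \<open>x \<in> Y\<close>] \<theta>(2)[OF x, of T] T D_neg by (simp add: t0_def)
  \<comment> \<open>The minimum over \<open>Y\<close> is global on \<open>S\<close>: it is negative,
    and \<open>D\<close> is nonnegative outside \<open>Y\<close>.\<close>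
  have min: "D t0 x0 \<le> D s y" if "y \<in> S" "s \<in> {0..T}" for s y
  proof (cases "D s y < 0")
    case True
    then show ?thesis
      using outside[OF that True] x0(2)[of y] \<theta>(2)[OF that] by (simp add: t0_def)
  qed (use D0_neg in simp)
  \<comment> \<open>At time zero \<open>D\<close> equals \<open>V - \<phi> + \<delta> > 0\<close>.
    Hence left difference quotients at \<open>t0\<close> make sense.\<close>
  have "0 < t0"
  proof (rule ccontr)
    assume "\<not> 0 < t0"
    then have "t0 = 0" using t0 by simp
    then have "D t0 x0 = V x0 - \<phi> x0 + \<delta>"
      using at_zero[OF x0_S] by (simp add: D_def W_def u_def)
    then show False using below[OF x0_S] \<delta> D0_neg by simp
  qed
  define W' where "W' = exp (- c * t0) * (- c * V x0 + b)"
  have "((\<lambda>t. W t x0) has_real_derivative W') (at t0)"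
    unfolding W_def W'_def using c
    by (auto intro!: derivative_eq_intros simp: field_simps)
  then have "((\<lambda>h. (W (t0 + h) x0 - W t0 x0) / h) \<longlongrightarrow> W') (at 0)"
    by (simp add: DERIV_def)
  \<comment> \<open>The derivative is rewritten as a left quotient with positive \<open>h\<close>,
    the form of \<open>left_derivative\<close>.\<close>
  then have "((\<lambda>h. (W (t0 + - h) x0 - W t0 x0) / - h) \<longlongrightarrow> W') (at_right 0)"
    by (simp add: at_left_minus filterlim_at_split filterlim_filtermap)
  then have "((\<lambda>h. (W (t0 + - h) x0 - W t0 x0) / - h - (u t0 x0 - u (t0 - h) x0) / h + \<delta>)
      \<longlongrightarrow> W' - gen (u t0) x0 + \<delta>) (at_right 0)"
    using left_derivative[of x0 t0 \<phi> M, OF x0_S \<open>0 < t0\<close> bounded]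
    by (intro tendsto_intros) (auto simp: u_def[abs_def])
  moreover have "\<forall>\<^sub>F h in at_right 0.
      (W (t0 + - h) x0 - W t0 x0) / - h - (u t0 x0 - u (t0 - h) x0) / h + \<delta> \<le> 0"
  proof (rule eventually_at_rightI[OF _ \<open>0 < t0\<close>])
    fix h assume h: "h \<in> {0<..<t0}"
    have "(W (t0 + - h) x0 - W t0 x0) / - h - (u t0 x0 - u (t0 - h) x0) / h + \<delta>
        = (D t0 x0 - D (t0 - h) x0) / h"
      using h by (simp add: D_def field_simps)
    also have "\<dots> \<le> 0"
      using h t0 min[OF x0_S, of "t0 - h"] by (intro divide_nonpos_pos) auto
    finally show "(W (t0 + - h) x0 - W t0 x0) / - h - (u t0 x0 - u (t0 - h) x0) / h + \<delta> \<le> 0" .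
  qed
  ultimately have "W' - gen (u t0) x0 + \<delta> \<le> 0"
    by (rule tendsto_upperbound) simp
  moreover have "0 \<le> gen (\<lambda>y. D t0 y) x0"
    unfolding gen_def
    using rate_nonneg[OF x0_S] min target_closed[OF x0_S] t0
    by (intro sum_nonneg mult_nonneg_nonneg) auto
  \<comment> \<open>Terms independent of \<open>y\<close> cancel in the differences that make up
    \<open>gen\<close>.\<close>
  moreover have "gen (\<lambda>y. D t0 y) x0 = exp (- c * t0) * gen V x0 - gen (u t0) x0"
    by (simp add: gen_def D_def W_def sum_distrib_left sum_subtractf[symmetric] algebra_simps)
  moreover have "exp (- c * t0) * gen V x0 \<le> W'"
    unfolding W'_def using drift[OF x0_S] by (intro mult_left_mono) auto
  ultimately show False using \<delta> by linarith
qed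

text \<open>\<open>drift_bound\<close> holds for every \<open>min V n\<close> with a right-hand side
  free of \<open>n\<close>.\<close>

lemma drift_expectation:
  fixes V :: "'a \<Rightarrow> real"
  assumes sublevel: "\<And>m. finite {y \<in> S. V y \<le> m}"
    and V_nonneg: "\<And>y. 0 \<le> V y"
    and c: "0 < c" and b: "0 \<le> b"
    and drift: "\<And>y. y \<in> S \<Longrightarrow> gen V y \<le> - c * V y + b"
    and t: "0 \<le> t" and x: "x \<in> S"
  shows "integrable (measure_pmf (\<kappa> t x)) V"
    and "measure_pmf.expectation (\<kappa> t x) V \<le> exp (- c * t) * V x + b / c"
proof -
  have "measure_pmf.expectation (\<kappa> t x) (\<lambda>y. min (V y) (real n)) \<le> exp (- c * t) * V x + b / c" for n
    using V_nonneg by (intro drift_bound[where V = V and M = n, OF _ _ sublevel _ c b drift t x]) auto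
  from integrable_pmf_truncated[OF V_nonneg this]
  show "integrable (measure_pmf (\<kappa> t x)) V"
    "measure_pmf.expectation (\<kappa> t x) V \<le> exp (- c * t) * V x + b / c" .
qed

text \<open>The integral of \<open>V\<close> is not known to be finite in advance, so the drift
  estimate cannot be integrated directly. By invariance, a truncation at \<open>n\<close> is bounded
  in mean by \<open>min n (exp (- c * m) * V + b / c)\<close>; dominated convergence in
  \<open>m\<close> comes first, then \<open>n\<close> grows.\<close>

lemma drift_invariant:
  fixes V :: "'a \<Rightarrow> real"
  assumes sublevel: "\<And>m. finite {y \<in> S. V y \<le> m}"
    and V_nonneg: "\<And>y. 0 \<le> V y"
    and c: "0 < c" and b: "0 \<le> b"
    and drift: "\<And>y. y \<in> S \<Longrightarrow> gen V y \<le> - c * V y + b"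
    and \<pi>: "set_pmf \<pi> \<subseteq> S" "\<And>t. 0 \<le> t \<Longrightarrow> bind_pmf \<pi> (\<kappa> t) = \<pi>"
  shows "integrable (measure_pmf \<pi>) V" and "measure_pmf.expectation \<pi> V \<le> b / c"
proof -
  have "measure_pmf.expectation \<pi> (\<lambda>y. min (V y) (real n)) \<le> b / c" for n
  proof -
    define g where "g m y = min (real n) (exp (- c * real m) * V y + b / c)" for m y
    have bounded: "\<bar>min (V y) (real n)\<bar> \<le> real n" for y
      using V_nonneg by auto
    have g: "\<bar>g m y\<bar> \<le> real n" for m y
      using V_nonneg b c by (auto simp: g_def)
    have "measure_pmf.expectation \<pi> (\<lambda>y. min (V y) (real n)) \<le> measure_pmf.expectation \<pi> (g m)" for m
    proof -
      have "measure_pmf.expectation \<pi> (\<lambda>y. min (V y) (real n))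
          = measure_pmf.expectation \<pi> (\<lambda>y. measure_pmf.expectation (\<kappa> (real m) y) (\<lambda>y. min (V y) (real n)))"
        using expectation_bind_pmf[of "\<lambda>y. min (V y) (real n)" n \<pi> "\<kappa> (real m)"] bounded \<pi>(2)[of "real m"]
        by simp
      also have "\<dots> \<le> measure_pmf.expectation \<pi> (g m)"
      proof (rule integral_mono_AE)
        show "AE y in measure_pmf \<pi>.
            measure_pmf.expectation (\<kappa> (real m) y) (\<lambda>y. min (V y) (real n)) \<le> g m y"
        proof (rule AE_pmfI)
          fix y assume "y \<in> set_pmf \<pi>"
          then have y: "y \<in> S" using \<pi> by auto
          have "measure_pmf.expectation (\<kappa> (real m) y) (\<lambda>y. min (V y) (real n)) \<le> real n"
            using expectation_pmf_bounded[of "\<lambda>y. min (V y) (real n)", OF bounded] by (simp add: abs_le_iff)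
          moreover have "measure_pmf.expectation (\<kappa> (real m) y) (\<lambda>y. min (V y) (real n))
              \<le> exp (- c * real m) * V y + b / c"
            using V_nonneg y
            by (intro drift_bound[where V = V and M = n, OF _ _ sublevel _ c b drift]) auto
          ultimately show "measure_pmf.expectation (\<kappa> (real m) y) (\<lambda>y. min (V y) (real n)) \<le> g m y"
            by (simp add: g_def)
        qed
      qed (auto intro!: integrable_pmf_bounded[where M = n] expectation_pmf_bounded bounded g)
      finally show ?thesis .
    qed
    moreover have "(\<lambda>m. measure_pmf.expectation \<pi> (g m))
        \<longlonglongrightarrow> measure_pmf.expectation \<pi> (\<lambda>_. min (real n) (b / c))"
    proof (rule integral_dominated_convergence[where w = "\<lambda>_. real n"])
      have "(\<lambda>m. exp (- c * real m)) \<longlonglongrightarrow> 0"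
        using c by real_asymp
      then have "(\<lambda>m. g m y) \<longlonglongrightarrow> min (real n) (0 * V y + b / c)" for y
        unfolding g_def by (intro tendsto_intros)
      then show "AE y in measure_pmf \<pi>. (\<lambda>m. g m y) \<longlonglongrightarrow> min (real n) (b / c)" by simp
    qed (use g in auto)
    ultimately have "measure_pmf.expectation \<pi> (\<lambda>y. min (V y) (real n)) \<le> min (real n) (b / c)"
      by (intro LIMSEQ_le_const[where X = "\<lambda>m. measure_pmf.expectation \<pi> (g m)"]) auto
    then show ?thesis by simp
  qed
  from integrable_pmf_truncated[OF V_nonneg this]
  show "integrable (measure_pmf \<pi>) V" "measure_pmf.expectation \<pi> V \<le> b / c" .
qed

section \<open>Reachability between states\<close>

text \<open>Over short times the mass at \<open>x\<close> is positive, and any \<open>t\<close> is a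
  multiple of such a short time.\<close>

lemma self_reachable:
  assumes x: "x \<in> S" and t: "0 \<le> t"
  shows "x \<in> set_pmf (\<kappa> t x)"
proof -
  have "\<forall>\<^sub>F h in at_right 0. 0 < pmf (\<kappa> h x) x"
    using order_tendstoD(1)[OF pmf_self_tendsto[OF x], of 0] by simp
  then obtain d where d: "0 < d" "\<And>h. 0 < h \<Longrightarrow> h < d \<Longrightarrow> x \<in> set_pmf (\<kappa> h x)"
    by (fastforce simp: eventually_at_right_field set_pmf_iff)
  have iterate: "x \<in> set_pmf (\<kappa> (real n * h) x)" if "0 < h" "h < d" for n h
  proof (induction n)
    case 0
    then show ?case using x by (simp add: at_zero)
  next
    case (Suc n)
    have "\<kappa> (real (Suc n) * h) x = bind_pmf (\<kappa> (real n * h) x) (\<kappa> h)"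
      using semigroup[OF x, of "real n * h" h] that by (simp add: algebra_simps)
    then show ?case using Suc d(2)[OF that] by auto
  qed
  obtain n where n: "t / d < real n" using reals_Archimedean2 by blast
  show ?thesis
  proof (cases "t = 0")
    case False
    have "0 < real n" using n t d by (smt (verit) divide_nonneg_pos)
    then show ?thesis
      using iterate[of "t / real n" n] n t d False by (simp add: field_simps)
  qed (use x in \<open>simp add: at_zero\<close>)
qed

text \<open>A positive rate gives the probability of the target a positive derivative at time zero.
  The time \<open>h\<close> stays below \<open>t\<close> so that further jumps fit into the
  remainder.\<close>

lemma jump_reachable:
  assumes x: "x \<in> S" and k: "k \<in> J x" "0 < rate x k" "target x k \<noteq> x" and t: "0 < t"
  obtains h where "0 < h" "h < t" "target x k \<in> set_pmf (\<kappa> h x)"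
proof -
  let ?y = "target x k"
  have "rate x k * (indicator {?y} ?y - indicator {?y} x)
      \<le> gen (indicator {?y}) x"
    unfolding gen_def using k finite_jumps[OF x] rate_nonneg[OF x]
    by (intro member_le_sum) (auto simp: indicator_def)
  then have "0 < gen (indicator {?y}) x" using k by (simp add: indicator_def)
  then have "\<forall>\<^sub>F h in at_right 0. 0 < (measure_pmf.prob (\<kappa> h x) {?y} - indicator {?y} x) / h"
    using order_tendstoD(1)[OF transition_rate[OF x, of "{?y}"]] by simp
  then obtain d where d: "0 < d"
    "\<And>h. 0 < h \<Longrightarrow> h < d \<Longrightarrow> 0 < (measure_pmf.prob (\<kappa> h x) {?y} - indicator {?y} x) / h"
    by (auto simp: eventually_at_right_field)
  show thesis
  proof (rule that[of "min d t / 2"])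
    have h: "0 < min d t / 2" "min d t / 2 < d" using d t by (auto simp: min_def)
    show "0 < min d t / 2" "min d t / 2 < t" using d t by (auto simp: min_def)
    show "?y \<in> set_pmf (\<kappa> (min d t / 2) x)"
      using d(2)[OF h] k h(1) by (auto simp: measure_pmf_single zero_less_divide_iff set_pmf_iff)
  qed
qed

text \<open>The contraction is iterated for the kernel at time 1, starting from a function bounded
  by 1 that absorbs the fractional part of \<open>t\<close>. The oscillation bound is then averaged
  over \<open>\<pi>\<close>, for which \<open>V\<close> is integrable.\<close>

theorem exponential_ergodicity:
  fixes V :: "'a \<Rightarrow> real"
  assumes sublevel: "\<And>m. finite {y \<in> S. V y \<le> m}"
    and V_ge_1: "\<And>y. 1 \<le> V y"
    and c: "0 < c" and b: "0 \<le> b"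
    and drift: "\<And>y. y \<in> S \<Longrightarrow> gen V y \<le> - c * V y + b"
    and \<pi>: "set_pmf \<pi> \<subseteq> S" "\<And>t. 0 \<le> t \<Longrightarrow> bind_pmf \<pi> (\<kappa> t) = \<pi>"
    and z: "z \<in> S" "\<And>x. x \<in> S \<Longrightarrow> z \<in> set_pmf (\<kappa> 1 x)"
  obtains C \<rho> where "0 < C" "0 < \<rho>" "\<rho> < 1"
    "\<And>x t A. x \<in> S \<Longrightarrow> 0 \<le> t \<Longrightarrow>
      \<bar>measure_pmf.prob (\<kappa> t x) A - measure_pmf.prob \<pi> A\<bar> \<le> C * \<rho> powr t * V x"
proof -
  have V_nonneg: "0 \<le> V y" for y using V_ge_1[of y] by simp
  note V = drift_expectation[OF sublevel V_nonneg c b drift]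
  note V_\<pi> = drift_invariant[OF sublevel V_nonneg c b drift \<pi>]
  define g where "g = exp (- c)"
  \<comment> \<open>Leaves slack 1 in the condition of \<open>harris_contraction\<close>, whose
    drift constant is here \<open>b / c\<close>.\<close>
  define R where "R = (2 * (b / c) + 1) / (1 - g)"
  have g: "0 \<le> g" "g < 1" using c by (auto simp: g_def)
  have R: "2 * (b / c) < (1 - g) * R" using g by (simp add: R_def)
  \<comment> \<open>Positive, because the sublevel set is finite and \<open>z\<close> is reached
    from each of its states. The inserted 1 covers an empty set and gives
    \<open>\<epsilon> \<le> 1\<close>.\<close>
  define \<epsilon> where "\<epsilon> = Min (insert 1 ((\<lambda>x. pmf (\<kappa> 1 x) z) ` {x \<in> S. V x \<le> R}))"
  have \<epsilon>: "0 < \<epsilon>" "\<epsilon> \<le> 1"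
    using sublevel z(2) by (auto simp: \<epsilon>_def pmf_positive)
  have minor: "\<epsilon> \<le> pmf (\<kappa> 1 x) z" if "x \<in> S" "V x \<le> R" for x
    using sublevel that by (auto simp: \<epsilon>_def intro!: Min_le)
  obtain a \<beta> where a: "0 < a" "a < 1" "0 < \<beta>"
    and contraction: "\<And>\<phi> M D x y. \<lbrakk>\<And>u. \<bar>\<phi> u\<bar> \<le> M; 0 \<le> D;
       \<And>u v. u \<in> S \<Longrightarrow> v \<in> S \<Longrightarrow> \<bar>\<phi> u - \<phi> v\<bar> \<le> D * (2 + \<beta> * V u + \<beta> * V v);
       x \<in> S; y \<in> S\<rbrakk> \<Longrightarrow>
       \<bar>measure_pmf.expectation (\<kappa> 1 x) \<phi> - measure_pmf.expectation (\<kappa> 1 y) \<phi>\<bar>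
         \<le> a * D * (2 + \<beta> * V x + \<beta> * V y)"
  proof (rule harris_contraction[of S "\<kappa> 1" V g "b / c" R z \<epsilon>])
    show "measure_pmf.expectation (\<kappa> 1 x) V \<le> g * V x + b / c" if "x \<in> S" for x
      using V(2)[of 1 x] that by (simp add: g_def)
  qed (use closed V_nonneg V(1) g b c R z \<epsilon> minor in auto)
  define B where "B = measure_pmf.expectation \<pi> V"
  have B: "0 \<le> B" unfolding B_def using V_nonneg by simp
  \<comment> \<open>The division by \<open>a\<close> pays for
    \<open>a ^ n \<le> a powr (t - 1)\<close>, the loss from rounding \<open>t\<close> down.\<close>
  define C where "C = (2 + \<beta> + \<beta> * B) / a"
  show thesis
  proof (rule that[of C a])
    show "0 < C" using a B by (simp add: C_def add_pos_nonneg)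
    show "0 < a" "a < 1" by (fact a)+
    fix x t A assume x: "x \<in> S" and t: "0 \<le> (t::real)"
    define n where "n = nat \<lfloor>t\<rfloor>"
    define s where "s = t - real n"
    have n: "real n \<le> t" "t < real n + 1" using t by (auto simp: n_def)
    \<comment> \<open>Since \<open>s + n = t\<close>, \<open>\<phi> n\<close> is the probability at
      time \<open>t\<close>; passing from \<open>k\<close> to \<open>k + 1\<close> applies
      \<open>\<kappa> 1\<close> once.\<close>
    define \<phi> where "\<phi> k y = measure_pmf.prob (\<kappa> (s + real k) y) A" for k y
    have \<phi>: "\<bar>\<phi> k y\<bar> \<le> 1" for k y by (simp add: \<phi>_def)
    have osc: "\<bar>\<phi> k y - \<phi> k v\<bar> \<le> a ^ k * (2 + \<beta> * V y + \<beta> * V v)" if "y \<in> S" "v \<in> S" for k y v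
      using that
    proof (induction k arbitrary: y v)
      case 0
      have "\<bar>\<phi> 0 y - \<phi> 0 v\<bar> \<le> 2" using \<phi>[of 0 y] \<phi>[of 0 v] by linarith
      moreover have "0 \<le> \<beta> * V y" "0 \<le> \<beta> * V v" using a V_nonneg by auto
      ultimately show ?case by simp
    next
      case (Suc k)
      have step: "\<phi> (Suc k) y = measure_pmf.expectation (\<kappa> 1 y) (\<phi> k)" if "y \<in> S" for y
        using expectation_semigroup[OF that, of 1 "s + real k" "indicator A" 1] n
        by (simp add: \<phi>_def[abs_def] s_def algebra_simps)
      show ?case
        using contraction[of "\<phi> k" 1 "a ^ k" y v] \<phi> Suc a by (simp add: step)
    qed
    have "measure_pmf.prob \<pi> A = measure_pmf.expectation \<pi> (\<phi> n)"
      using expectation_bind_pmf[of "indicator A" 1 \<pi> "\<kappa> t"] \<pi>(2)[OF t]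
      by (simp add: \<phi>_def[abs_def] s_def)
    moreover have \<phi>_x: "measure_pmf.prob (\<kappa> t x) A = \<phi> n x"
      by (simp add: \<phi>_def s_def)
    ultimately have "measure_pmf.prob (\<kappa> t x) A - measure_pmf.prob \<pi> A
        = measure_pmf.expectation \<pi> (\<lambda>y. \<phi> n x - \<phi> n y)"
      using integrable_pmf_bounded[of "\<phi> n" 1 \<pi>] \<phi> by simp
    also have "\<bar>\<dots>\<bar> \<le> measure_pmf.expectation \<pi> (\<lambda>y. \<bar>\<phi> n x - \<phi> n y\<bar>)"
      by (rule integral_abs_bound)
    also have "\<dots> \<le> measure_pmf.expectation \<pi> (\<lambda>y. a ^ n * (2 + \<beta> * V x + \<beta> * V y))"
      using integrable_pmf_bounded[of "\<phi> n" 1 \<pi>] \<phi> V_\<pi>(1) osc[OF x] \<pi>(1)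
      by (intro integral_mono_AE) (auto simp: AE_measure_pmf_iff)
    also have "\<dots> = a ^ n * (2 + \<beta> * V x + \<beta> * B)"
      using V_\<pi>(1) by (simp add: B_def)
    \<comment> \<open>The constants are absorbed into \<open>V x \<ge> 1\<close>.\<close>
    also have "\<dots> \<le> a powr (t - 1) * ((2 + \<beta> + \<beta> * B) * V x)"
    proof (intro mult_mono)
      show "a ^ n \<le> a powr (t - 1)"
        using n a by (simp add: powr_realpow[symmetric] powr_mono')
      have "\<beta> * B * 1 \<le> \<beta> * B * V x"
        using V_ge_1[of x] a B by (intro mult_left_mono) (auto simp del: mult_1_right)
      then show "2 + \<beta> * V x + \<beta> * B \<le> (2 + \<beta> + \<beta> * B) * V x"
        using V_ge_1[of x] by (simp add: algebra_simps)
      show "0 \<le> 2 + \<beta> * V x + \<beta> * B" using a B V_nonneg[of x] by simp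
    qed simp
    also have "\<dots> = C * a powr t * V x"
      using a by (simp add: C_def powr_diff)
    finally show "\<bar>measure_pmf.prob (\<kappa> t x) A - measure_pmf.prob \<pi> A\<bar> \<le> C * a powr t * V x" .
  qed
qed

end

section \<open>Transition kernels of a continuous-time Markov chain\<close>

text \<open>As a pmf, the law composes by \<open>bind_pmf\<close>. \<open>Abs_pmf\<close> is
  meaningful once the law is known to be discrete, which is shown for \<open>x\<close> in
  \<open>S\<close> and \<open>t \<ge> 0\<close>.\<close>

definition transition_pmf ::
  "('a \<Rightarrow> 'w measure) \<Rightarrow> (real \<Rightarrow> 'w \<Rightarrow> 'a) \<Rightarrow> real \<Rightarrow> 'a \<Rightarrow> 'a pmf" where
  "transition_pmf P X t x = Abs_pmf (distr (P x) (count_space UNIV) (X t))"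

context
  fixes S :: "'a set" and L :: "('a \<Rightarrow> real) \<Rightarrow> 'a \<Rightarrow> real"
    and P :: "'a \<Rightarrow> 'w measure" and X :: "real \<Rightarrow> 'w \<Rightarrow> 'a"
  assumes chain: "continuous_time_markov_chain S L P X" and countable: "countable S"
begin

lemma prob_space_chain: "x \<in> S \<Longrightarrow> prob_space (P x)"
  using chain by (simp add: continuous_time_markov_chain_def)

lemma measurable_chain: "x \<in> S \<Longrightarrow> 0 \<le> t \<Longrightarrow> X t \<in> measurable (P x) (count_space S)"
  using chain by (simp add: continuous_time_markov_chain_def)

lemma measurable_chain_UNIV:
  assumes "x \<in> S" "0 \<le> t"
  shows "X t \<in> measurable (P x) (count_space UNIV)"
proof -
  have "(\<lambda>y. y) \<in> measurable (count_space S) (count_space UNIV)" by simp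
  from measurable_compose[OF measurable_chain[OF assms] this] show ?thesis .
qed

lemma chain_in_states: "x \<in> S \<Longrightarrow> 0 \<le> t \<Longrightarrow> \<omega> \<in> space (P x) \<Longrightarrow> X t \<omega> \<in> S"
  using measurable_space[OF measurable_chain] by fastforce

text \<open>The law is carried by the countable set \<open>S\<close>, so almost every point has
  positive mass, as the type of pmfs demands.\<close>

lemma measure_transition_pmf:
  assumes x: "x \<in> S" "0 \<le> t"
  shows "measure_pmf (transition_pmf P X t x) = distr (P x) (count_space UNIV) (X t)"
proof -
  interpret prob_space "P x" using x by (intro prob_space_chain)
  interpret D: prob_space "distr (P x) (count_space UNIV) (X t)"
    using measurable_chain_UNIV[OF x] by (rule prob_space_distr)
  have "AE y in distr (P x) (count_space UNIV) (X t). y \<in> S"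
    using measurable_chain_UNIV[OF x] chain_in_states[OF x] by (simp add: AE_distr_iff)
  then have "AE y in distr (P x) (count_space UNIV) (X t).
      measure (distr (P x) (count_space UNIV) (X t)) {y} \<noteq> 0"
    using D.AE_support_countable countable by auto
  then show ?thesis
    unfolding transition_pmf_def by (intro Abs_pmf_inverse) (simp add: D.prob_space_axioms)
qed

lemma prob_transition_pmf:
  assumes "x \<in> S" "0 \<le> t"
  shows "measure_pmf.prob (transition_pmf P X t x) A = measure (P x) {\<omega> \<in> space (P x). X t \<omega> \<in> A}"
  using measurable_chain_UNIV[OF assms]
  by (simp add: measure_transition_pmf[OF assms] measure_distr vimage_def Int_def conj_commute)

lemma pmf_transition_pmf:
  assumes "x \<in> S" "0 \<le> t"
  shows "pmf (transition_pmf P X t x) y = measure (P x) {\<omega> \<in> space (P x). X t \<omega> = y}"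
  using prob_transition_pmf[OF assms, of "{y}"] by (simp add: measure_pmf_single)

lemma expectation_transition_pmf:
  fixes f :: "'a \<Rightarrow> real"
  assumes "x \<in> S" "0 \<le> t"
  shows "measure_pmf.expectation (transition_pmf P X t x) f = (LINT \<omega>|P x. f (X t \<omega>))"
  using measurable_chain_UNIV[OF assms]
  by (simp add: measure_transition_pmf[OF assms] integral_distr)

lemma set_transition_pmf:
  assumes "x \<in> S" "0 \<le> t"
  shows "set_pmf (transition_pmf P X t x) \<subseteq> S"
proof -
  have "AE y in transition_pmf P X t x. y \<in> S"
    unfolding measure_transition_pmf[OF assms]
    using measurable_chain_UNIV[OF assms] chain_in_states[OF assms] by (simp add: AE_distr_iff)
  then show ?thesis by (auto simp: AE_measure_pmf_iff)
qed

lemma transition_pmf_0: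
  assumes "x \<in> S"
  shows "transition_pmf P X 0 x = return_pmf x"
proof -
  have "AE \<omega> in P x. X 0 \<omega> = x"
    using chain assms by (simp add: continuous_time_markov_chain_def)
  then have "AE y in transition_pmf P X 0 x. y = x"
    unfolding measure_transition_pmf[OF assms order_refl]
    using measurable_chain_UNIV[OF assms] by (simp add: AE_distr_iff)
  then show ?thesis by (auto simp: AE_measure_pmf_iff set_pmf_subset_singleton[symmetric])
qed

text \<open>Chapman-Kolmogorov: the Markov property with the whole space as past event, summed over
  the countably many values of \<open>X s\<close>.\<close>

lemma transition_pmf_add:
  assumes x: "x \<in> S" and s: "0 \<le> s" and t: "0 \<le> t"
  shows "transition_pmf P X (s + t) x = bind_pmf (transition_pmf P X s x) (transition_pmf P X t)"
proof (rule pmf_eqI)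
  fix z
  interpret prob_space "P x" using x by (rule prob_space_chain)
  have st: "0 \<le> s + t" using s t by simp
  note X_s = measurable_chain[OF x s] and X_st = measurable_chain[OF x st]
  show "pmf (transition_pmf P X (s + t) x) z
      = pmf (bind_pmf (transition_pmf P X s x) (transition_pmf P X t)) z"
  proof (cases "z \<in> S")
    case False
    then have "z \<notin> set_pmf (transition_pmf P X (s + t) x)"
      "z \<notin> set_pmf (bind_pmf (transition_pmf P X s x) (transition_pmf P X t))"
      using set_transition_pmf[OF x s] set_transition_pmf[OF x st] set_transition_pmf[OF _ t]
      unfolding set_bind_pmf by blast+
    then show ?thesis unfolding pmf_eq_0_set_pmf[symmetric] by simp
  next
    case True
    define E where "E y = {\<omega> \<in> space (P x). X s \<omega> = y \<and> X (s + t) \<omega> = z}" for y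
    have E_sets: "E y \<in> sets (P x)" if "y \<in> S" for y
    proof -
      have "E y = (X s -` {y} \<inter> space (P x)) \<inter> (X (s + t) -` {z} \<inter> space (P x))"
        by (auto simp: E_def)
      then show ?thesis
        using measurable_sets[OF X_s, of "{y}"] measurable_sets[OF X_st, of "{z}"] that True by auto
    qed
    have "space (P x) \<in> past_events S (P x) X s"
      unfolding past_events_def by (rule sigma_sets_top)
    moreover have "\<forall>A\<in>past_events S (P x) X s. \<forall>y\<in>S. \<forall>z\<in>S.
        measure (P x) {\<omega>\<in>A. X s \<omega> = y \<and> X (s + t) \<omega> = z} =
        measure (P x) {\<omega>\<in>A. X s \<omega> = y} * measure (P y) {\<omega>\<in>space (P y). X t \<omega> = z}"
      using chain x s t unfolding continuous_time_markov_chain_def by blast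
    ultimately have markov: "measure (P x) (E y)
        = pmf (transition_pmf P X s x) y * pmf (transition_pmf P X t y) z" if "y \<in> S" for y
      using that True unfolding E_def pmf_transition_pmf[OF x s] pmf_transition_pmf[OF that t] by blast
    have "{\<omega> \<in> space (P x). X (s + t) \<omega> = z} = (\<Union>y\<in>S. E y)"
      using chain_in_states[OF x s] by (auto simp: E_def)
    then have "ennreal (pmf (transition_pmf P X (s + t) x) z) = emeasure (P x) (\<Union>y\<in>S. E y)"
      using x st by (simp add: pmf_transition_pmf emeasure_eq_measure)
    also have "\<dots> = (\<integral>\<^sup>+ y. emeasure (P x) (E y) \<partial>count_space S)"
      using E_sets countable
      by (intro emeasure_UN_countable) (auto simp: disjoint_family_on_def E_def)
    also have "\<dots> = (\<integral>\<^sup>+ y. ennreal (pmf (transition_pmf P X s x) y)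
        * ennreal (pmf (transition_pmf P X t y) z) \<partial>count_space S)"
      using markov by (intro nn_integral_cong) (auto simp: emeasure_eq_measure ennreal_mult)
    \<comment> \<open>The mass at time \<open>s\<close> vanishes outside \<open>S\<close>, so the
      sum extends to the whole type.\<close>
    also have "\<dots> = (\<integral>\<^sup>+ y. ennreal (pmf (transition_pmf P X s x) y)
        * ennreal (pmf (transition_pmf P X t y) z) \<partial>count_space UNIV)"
      using set_transition_pmf[OF x s]
      by (subst nn_integral_count_space_indicator)
        (auto simp: indicator_def pmf_eq_0_set_pmf intro!: nn_integral_cong)
    also have "\<dots> = ennreal (pmf (bind_pmf (transition_pmf P X s x) (transition_pmf P X t)) z)"
      by (simp add: ennreal_pmf_bind nn_integral_measure_pmf)
    finally show ?thesis by simp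
  qed
qed

lemma transition_pmf_right_derivative:
  assumes x: "x \<in> S" and f: "finite {y. f y \<noteq> 0}"
  shows "((\<lambda>h. (measure_pmf.expectation (transition_pmf P X h x) f - f x) / h) \<longlongrightarrow> L f x) (at_right 0)"
proof -
  have "((\<lambda>h. ((LINT \<omega>|P x. f (X h \<omega>)) - f x) / h) \<longlongrightarrow> L f x) (at_right 0)"
    using chain x f by (simp add: continuous_time_markov_chain_def)
  moreover have "\<forall>\<^sub>F h in at_right 0. ((LINT \<omega>|P x. f (X h \<omega>)) - f x) / h
      = (measure_pmf.expectation (transition_pmf P X h x) f - f x) / h"
    using eventually_at_right_less
    by eventually_elim (simp add: expectation_transition_pmf[OF x])
  ultimately show ?thesis
    by (rule Lim_transform_eventually)
qed

text \<open>Invariance is given at points of \<open>S\<close>; elsewhere both masses vanish.\<close>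

lemma invariant_bind_transition_pmf:
  assumes inv: "invariant_distribution S P X \<pi>" and t: "0 \<le> t"
  shows "bind_pmf \<pi> (transition_pmf P X t) = \<pi>"
proof (rule pmf_eqI)
  fix y
  have \<pi>: "set_pmf \<pi> \<subseteq> S" using inv by (simp add: invariant_distribution_def)
  show "pmf (bind_pmf \<pi> (transition_pmf P X t)) y = pmf \<pi> y"
  proof (cases "y \<in> S")
    case True
    have "pmf (bind_pmf \<pi> (transition_pmf P X t)) y
        = measure_pmf.expectation \<pi> (\<lambda>x. measure (P x) {\<omega> \<in> space (P x). X t \<omega> = y})"
      unfolding pmf_bind using \<pi> t
      by (intro integral_cong_AE) (auto simp: AE_measure_pmf_iff pmf_transition_pmf)
    then show ?thesis using inv t True by (simp add: invariant_distribution_def)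
  next
    case False
    then have "y \<notin> set_pmf \<pi>" "y \<notin> set_pmf (bind_pmf \<pi> (transition_pmf P X t))"
      using \<pi> set_transition_pmf[OF _ t] unfolding set_bind_pmf by blast+
    then show ?thesis unfolding pmf_eq_0_set_pmf[symmetric] by simp
  qed
qed

lemma tv_dist_transition_pmf:
  assumes x: "x \<in> S" and t: "0 \<le> t"
    and bound: "\<And>A. \<bar>measure_pmf.prob (transition_pmf P X t x) A - measure_pmf.prob \<pi> A\<bar> \<le> d"
  shows "tv_dist S (distr (P x) (count_space S) (X t)) (measure_pmf \<pi>) \<le> d"
  unfolding tv_dist_def
proof (rule cSUP_least)
  fix A assume "A \<in> Pow S"
  then have "measure (distr (P x) (count_space S) (X t)) A
      = measure_pmf.prob (transition_pmf P X t x) A"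
    using measurable_chain[OF x t]
    by (simp add: prob_transition_pmf[OF x t] measure_distr vimage_def Int_def conj_commute)
  then show "\<bar>measure (distr (P x) (count_space S) (X t)) A - measure_pmf.prob \<pi> A\<bar> \<le> d"
    using bound by simp
qed auto

end

section \<open>The matching queue\<close>

text \<open>No coordinate exceeds the norm, so the sublevel set lies in a finite box.\<close>

lemma finite_norm_sublevel: "finite {x :: 'v::finite \<Rightarrow> nat. euclidean_norm x \<le> m}"
proof (rule finite_subset)
  have "x i \<le> nat \<lceil>m\<rceil>" if "euclidean_norm x \<le> m" for x :: "'v \<Rightarrow> nat" and i
  proof -
    have "real (x i) \<le> euclidean_norm x"
      unfolding euclidean_norm_def by (rule member_le_L2_set) auto
    then show ?thesis using that by linarith
  qed
  then show "{x :: 'v \<Rightarrow> nat. euclidean_norm x \<le> m} \<subseteq> (\<Pi>\<^sub>E i\<in>UNIV. {..nat \<lceil>m\<rceil>})"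
    by auto
qed (auto intro: finite_PiE)

lemma finite_exp_norm_sublevel:
  assumes "\<alpha> > 0"
  shows "finite {x :: 'v::finite \<Rightarrow> nat. exp (\<alpha> * euclidean_norm x) \<le> m}"
proof (rule finite_subset[OF _ finite_norm_sublevel[of "ln m / \<alpha>"]])
  show "{x :: 'v \<Rightarrow> nat. exp (\<alpha> * euclidean_norm x) \<le> m} \<subseteq> {x. euclidean_norm x \<le> ln m / \<alpha>}"
  proof safe
    fix x :: "'v \<Rightarrow> nat" assume le: "exp (\<alpha> * euclidean_norm x) \<le> m"
    then have "0 < m" using exp_gt_zero less_le_trans by blast
    with le have "\<alpha> * euclidean_norm x \<le> ln m" by (simp add: ln_ge_iff)
    then show "euclidean_norm x \<le> ln m / \<alpha>" using assms by (simp add: field_simps)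
  qed
qed

section \<open>Jumps, rates and targets of the queue\<close>

text \<open>\<open>Inl i\<close> labels an arrival that is stored, \<open>Inr i\<close> a departure
  by reneging or matching.\<close>

definition queue_jumps :: "('v::finite \<Rightarrow> 'v \<Rightarrow> bool) \<Rightarrow> ('v \<Rightarrow> nat) \<Rightarrow> ('v + 'v) set" where
  "queue_jumps adj x = (- neighbours adj (supp x)) <+> supp x"

definition departure_rate ::
  "('v::finite \<Rightarrow> 'v \<Rightarrow> bool) \<Rightarrow> ('v \<times> 'v \<Rightarrow> real) \<Rightarrow> ('v \<times> 'v \<Rightarrow> real \<Rightarrow> real)
    \<Rightarrow> ('v \<Rightarrow> real) \<Rightarrow> ('v \<Rightarrow> real) \<Rightarrow> ('v \<Rightarrow> nat) \<Rightarrow> 'v \<Rightarrow> real" where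
  "departure_rate adj w F lam \<gamma> x i =
     \<gamma> i * real (x i) + (\<Sum>j\<in>neighbours adj {i}. lam j * match_prob adj w F x j i)"

definition queue_rate ::
  "('v::finite \<Rightarrow> 'v \<Rightarrow> bool) \<Rightarrow> ('v \<times> 'v \<Rightarrow> real) \<Rightarrow> ('v \<times> 'v \<Rightarrow> real \<Rightarrow> real)
    \<Rightarrow> ('v \<Rightarrow> real) \<Rightarrow> ('v \<Rightarrow> real) \<Rightarrow> ('v \<Rightarrow> nat) \<Rightarrow> 'v + 'v \<Rightarrow> real" where
  "queue_rate adj w F lam \<gamma> x = case_sum lam (departure_rate adj w F lam \<gamma> x)"

definition queue_target :: "('v \<Rightarrow> nat) \<Rightarrow> 'v + 'v \<Rightarrow> 'v \<Rightarrow> nat" where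
  "queue_target x = case_sum (\<lambda>i. x(i := x i + 1)) (\<lambda>i. x(i := x i - 1))"

lemma queue_generator_jumps:
  "queue_generator adj w F lam \<gamma> f x =
     (\<Sum>k\<in>queue_jumps adj x. queue_rate adj w F lam \<gamma> x k * (f (queue_target x k) - f x))"
  by (simp add: queue_generator_def queue_jumps_def sum.Plus queue_rate_def queue_target_def
      departure_rate_def)

text \<open>A stored arrival has no neighbour in the queue, by symmetry of the graph, and its class
  is no neighbour of itself. A departure only lowers coordinates, hence their products.\<close>

lemma queue_target_closed:
  assumes graph: "symp adj" "irreflp adj"
    and x: "x \<in> queue_states adj" and k: "k \<in> queue_jumps adj x"
  shows "queue_target x k \<in> queue_states adj"
proof (cases k)
  case (Inl i)
  then have "x j = 0" if "adj i j \<or> adj j i" for j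
    using k graph that by (auto simp: queue_jumps_def neighbours_def supp_def symp_def)
  moreover have "\<not> adj i i" using graph by (auto simp: irreflp_def)
  ultimately show ?thesis
    using Inl x by (auto simp: queue_target_def queue_states_def)
next
  case (Inr i)
  then have "queue_target x k j \<le> x j" for j by (simp add: queue_target_def)
  then have le: "queue_target x k j * queue_target x k l \<le> x j * x l" for j l
    by (intro mult_le_mono)
  have "queue_target x k j * queue_target x k l = 0" if "adj j l" for j l
  proof -
    have "x j * x l = 0" using x that unfolding queue_states_def by blast
    then show ?thesis using le[of j l] by (simp only: le_zero_eq)
  qed
  then show ?thesis unfolding queue_states_def by blast
qed

section \<open>Matching probabilities and departure rates\<close>

lemma match_prob_nonneg: "0 \<le> match_prob adj w F x j i"
  unfolding match_prob_def by (intro integral_nonneg_AE) auto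

lemma prob_space_error_law:
  assumes "\<And>e. e \<in> ordered_edges adj \<Longrightarrow> cumulative_distribution_function (F e)"
  shows "prob_space (error_law adj F)"
  unfolding error_law_def
proof (rule prob_space_PiM)
  fix e assume "e \<in> ordered_edges adj"
  then obtain M where M: "real_distribution M" "F e = cdf M"
    using assms unfolding cumulative_distribution_function_def by blast
  interpret real_distribution M by (fact M(1))
  have "real_distribution (interval_measure (F e))"
    unfolding M(2) using cdf_nondecreasing cdf_is_right_cont cdf_lim_at_bot cdf_lim_at_top_prob
    by (intro real_distribution_interval_measure) auto
  then show "prob_space (interval_measure (F e))"
    by (simp add: real_distribution_def)
qed

text \<open>For fixed errors the uniform choice spreads mass one over a nonempty finite set of
  maximisers; integration preserves this. Hence some stored neighbour is matched with positive
  probability.\<close>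

lemma match_prob_sum:
  assumes F: "\<And>e. e \<in> ordered_edges adj \<Longrightarrow> cumulative_distribution_function (F e)"
    and nonempty: "neighbours adj {j} \<inter> supp x \<noteq> {}"
  shows "(\<Sum>i\<in>neighbours adj {j} \<inter> supp x. match_prob adj w F x j i) = 1"
proof -
  define T where "T = neighbours adj {j} \<inter> supp x"
  define score where "score u i = max 0 (real (x i) + u (j, i)) + w (j, i)" for u i
  define best where "best u = best_matches adj w u x j" for u
  interpret prob_space "error_law adj F" using F by (rule prob_space_error_law)
  have best: "best u = {i \<in> T. \<forall>k\<in>T. score u k \<le> score u i}" for u
    by (auto simp: best_def best_matches_def is_arg_max_linorder T_def score_def supp_def)
  have best_nonempty: "best u \<noteq> {}" for u
    using ex_is_arg_min_if_finite[of T "\<lambda>i. - score u i"] nonempty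
    by (auto simp: best is_arg_min_linorder T_def)
  have score_measurable: "(\<lambda>u. score u i) \<in> borel_measurable (error_law adj F)" if "i \<in> T" for i
  proof -
    have "(j, i) \<in> ordered_edges adj"
      using that by (auto simp: T_def neighbours_def ordered_edges_def)
    from measurable_component_singleton[OF this, of "\<lambda>e. interval_measure (F e)"]
    have "(\<lambda>u. u (j, i)) \<in> borel_measurable (error_law adj F)"
      by (simp add: error_law_def cong: measurable_cong_sets)
    then show ?thesis unfolding score_def by measurable
  qed
  \<comment> \<open>Being a maximiser is a finite conjunction of comparisons between measurable
    scores.\<close>
  have ind_measurable: "(\<lambda>u. indicator (best u) i :: real) \<in> borel_measurable (error_law adj F)" for i
  proof (cases "i \<in> T")
    case True
    have "{u \<in> space (error_law adj F). \<forall>k\<in>T. score u k \<le> score u i} \<in> sets (error_law adj F)"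
      using score_measurable True
      by (intro sets.sets_Collect_finite_All borel_measurable_le) (auto simp: T_def)
    then have "(\<lambda>u. indicator {u \<in> space (error_law adj F). \<forall>k\<in>T. score u k \<le> score u i} u :: real)
        \<in> borel_measurable (error_law adj F)"
      by (rule borel_measurable_indicator)
    then show ?thesis
      by (rule measurable_cong[THEN iffD1, rotated]) (use True in \<open>auto simp: best indicator_def\<close>)
  qed (simp add: best)
  have card_best: "real (card (best u)) = (\<Sum>i\<in>T. indicator (best u) i)" for u
    by (simp add: indicator_def sum.If_cases best Int_def)
  have integrable: "integrable (error_law adj F)
      (\<lambda>u. indicator (best u) i / real (card (best u)))" for i
  proof (rule integrable_const_bound[where B = 1])
    show "(\<lambda>u. indicator (best u) i / real (card (best u))) \<in> borel_measurable (error_law adj F)"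
      unfolding card_best by (intro borel_measurable_divide borel_measurable_sum ind_measurable)
    have "1 \<le> card (best u)" for u
      using best_nonempty[of u] by (simp add: Suc_le_eq card_gt_0_iff)
    then show "AE u in error_law adj F. norm (indicator (best u) i / real (card (best u)) :: real) \<le> 1"
      by (auto simp: indicator_def divide_le_eq)
  qed
  have "(\<Sum>i\<in>T. match_prob adj w F x j i)
      = (LINT u|error_law adj F. (\<Sum>i\<in>T. indicator (best u) i / real (card (best u))))"
    unfolding match_prob_def best_def[symmetric] using integrable by simp
  also have "\<dots> = (LINT u|error_law adj F. 1)"
  proof (rule Bochner_Integration.integral_cong[OF refl])
    fix u
    have "real (card (best u)) \<noteq> 0" using best_nonempty[of u] by simp
    then show "(\<Sum>i\<in>T. indicator (best u) i / real (card (best u))) = (1::real)"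
      by (simp add: sum_divide_distrib[symmetric] card_best[symmetric])
  qed
  also have "\<dots> = 1" using prob_space by simp
  finally show ?thesis by (simp add: T_def)
qed

lemma departure_rate_nonneg:
  assumes "\<And>i. 0 < lam i" "\<And>i. 0 \<le> \<gamma> i"
  shows "0 \<le> departure_rate adj w F lam \<gamma> x i"
  unfolding departure_rate_def using assms
  by (intro add_nonneg_nonneg sum_nonneg mult_nonneg_nonneg match_prob_nonneg)
    (auto intro: less_imp_le)

text \<open>
  A class without reneging has a neighbour by \<open>Ncond\<close>, whose arrivals deplete some class of
  \<open>supp x\<close>, though not necessarily the given one.
\<close>

lemma departure_possible:
  assumes model: "matching_model adj w F lam \<gamma>" and ncond: "lam \<in> Ncond adj \<gamma>"
    and i: "i \<in> supp x"
  obtains k where "k \<in> supp x" "0 < departure_rate adj w F lam \<gamma> x k"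
proof (cases "\<gamma> i = 0")
  case False
  have pos: "0 < lam k" "0 \<le> \<gamma> k" for k
    using model by (auto simp: matching_model_def)
  then have "0 < \<gamma> i" using False by (simp add: order_less_le)
  then have "0 < departure_rate adj w F lam \<gamma> x i"
    unfolding departure_rate_def using i pos
    by (intro add_pos_nonneg sum_nonneg mult_nonneg_nonneg match_prob_nonneg)
      (auto simp: supp_def intro: less_imp_le)
  with i show thesis by (rule that)
next
  case True
  have pos: "0 < lam k" "0 \<le> \<gamma> k" for k
    using model by (auto simp: matching_model_def)
  have graph: "symp adj" "irreflp adj"
    using model by (auto simp: matching_model_def connected_simple_graph_def)
  have "{i} \<in> independent_sets adj (non_reneging \<gamma>)"
    using True graph by (auto simp: independent_sets_def non_reneging_def irreflp_def)
  then have "sum lam {i} < sum lam (neighbours adj {i})"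
    using ncond by (auto simp: Ncond_def)
  then have "neighbours adj {i} \<noteq> {}" using pos[of i] by auto
  then obtain j where "adj j i" by (auto simp: neighbours_def)
  then have "adj i j" using graph by (auto simp: symp_def)
  then have "neighbours adj {j} \<inter> supp x \<noteq> {}" using i by (auto simp: neighbours_def)
  then have "(\<Sum>k\<in>neighbours adj {j} \<inter> supp x. match_prob adj w F x j k) = 1"
    using model by (intro match_prob_sum) (auto simp: matching_model_def)
  then obtain k where k: "k \<in> neighbours adj {j} \<inter> supp x" "0 < match_prob adj w F x j k"
    using sum_nonpos[of "neighbours adj {j} \<inter> supp x" "match_prob adj w F x j"]
    by (metis not_less not_one_le_zero)
  then have "j \<in> neighbours adj {k}"
    using graph by (auto simp: neighbours_def symp_def)
  then have "0 < (\<Sum>j\<in>neighbours adj {k}. lam j * match_prob adj w F x j k)"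
    using k(2) pos(1)
    by (intro sum_pos2[of _ j]) (auto intro: mult_nonneg_nonneg less_imp_le match_prob_nonneg)
  then have "0 < departure_rate adj w F lam \<gamma> x k"
    using pos(2)[of k] by (simp add: departure_rate_def add_nonneg_pos)
  with k show thesis by (intro that) auto
qed

section \<open>The queue as a jump semigroup, with the empty queue as atom\<close>

lemma jump_semigroup_queue:
  assumes model: "matching_model adj w F lam \<gamma>"
    and chain: "continuous_time_markov_chain (queue_states adj) (queue_generator adj w F lam \<gamma>) P X"
  shows "jump_semigroup (queue_states adj) (transition_pmf P X) (queue_jumps adj)
    (queue_rate adj w F lam \<gamma>) queue_target"
proof -
  have countable: "countable (queue_states adj)" by (rule countableI_type)
  have graph: "symp adj" "irreflp adj" and rates: "\<And>i. 0 < lam i" "\<And>i. 0 \<le> \<gamma> i"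
    using model by (auto simp: matching_model_def connected_simple_graph_def)
  have rate: "0 \<le> queue_rate adj w F lam \<gamma> x k" for x k
    using departure_rate_nonneg[OF rates] rates
    by (auto simp: queue_rate_def less_imp_le split: sum.split)
  show ?thesis
  proof
    show "finite (queue_jumps adj x)" for x
      by (simp add: queue_jumps_def)
    show "((\<lambda>h. (measure_pmf.expectation (transition_pmf P X h x) f - f x) / h) \<longlongrightarrow>
        (\<Sum>k\<in>queue_jumps adj x. queue_rate adj w F lam \<gamma> x k * (f (queue_target x k) - f x)))
        (at_right 0)" if "x \<in> queue_states adj" "finite {y. f y \<noteq> 0}" for x f
      using transition_pmf_right_derivative[OF chain countable that]
      by (simp only: queue_generator_jumps)
  qed (rule set_transition_pmf[OF chain countable] transition_pmf_0[OF chain countable]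
      transition_pmf_add[OF chain countable] queue_target_closed[OF graph] rate; assumption)+
qed

text \<open>Induction on the number of stored items: a departure of positive rate happens before
  \<open>t\<close>, and the smaller queue empties in the time left. The empty queue can persist by
  \<open>self_reachable\<close>.\<close>

lemma empty_queue_reachable:
  assumes model: "matching_model adj w F lam \<gamma>" and ncond: "lam \<in> Ncond adj \<gamma>"
    and chain: "continuous_time_markov_chain (queue_states adj) (queue_generator adj w F lam \<gamma>) P X"
    and "x \<in> queue_states adj" "0 < t"
  shows "(\<lambda>_. 0) \<in> set_pmf (transition_pmf P X t x)"
proof -
  interpret jump_semigroup "queue_states adj" "transition_pmf P X" "queue_jumps adj"
    "queue_rate adj w F lam \<gamma>" queue_target
    using model chain by (rule jump_semigroup_queue)
  show ?thesis
    using assms(4,5)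
  proof (induction "sum x UNIV" arbitrary: x t)
    case 0
    then have "x = (\<lambda>_. 0)" by auto
    then show ?case using self_reachable[of x t] 0 by simp
  next
    case (Suc n)
    then obtain i where "i \<in> supp x"
      by (metis Zero_not_Suc gr0I mem_Collect_eq sum.neutral supp_def)
    then obtain k where k: "k \<in> supp x" "0 < departure_rate adj w F lam \<gamma> x k"
      using departure_possible[OF model ncond] by metis
    have jump: "Inr k \<in> queue_jumps adj x" "0 < queue_rate adj w F lam \<gamma> x (Inr k)"
      using k by (auto simp: queue_jumps_def queue_rate_def)
    let ?y = "queue_target x (Inr k)"
    have y: "?y = x(k := x k - 1)" by (simp add: queue_target_def)
    have x_k: "0 < x k" using k by (simp add: supp_def)
    then have "?y \<noteq> x" by (auto simp: y fun_eq_iff)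
    then obtain h where h: "0 < h" "h < t" "?y \<in> set_pmf (transition_pmf P X h x)"
      using jump_reachable[OF \<open>x \<in> queue_states adj\<close> jump _ \<open>0 < t\<close>] by metis
    have "sum x UNIV = x k + sum x (UNIV - {k})" "sum ?y UNIV = ?y k + sum ?y (UNIV - {k})"
      by (simp_all add: sum.remove)
    moreover have "sum ?y (UNIV - {k}) = sum x (UNIV - {k})"
      by (rule sum.cong) (auto simp: y)
    ultimately have "n = sum ?y UNIV" using Suc(2) x_k by (simp add: y)
    moreover have "?y \<in> queue_states adj"
      using target_closed[OF \<open>x \<in> queue_states adj\<close> jump(1)] .
    ultimately have "(\<lambda>_. 0) \<in> set_pmf (transition_pmf P X (t - h) ?y)"
      using Suc(1) h by simp
    then show ?case
      using semigroup[OF \<open>x \<in> queue_states adj\<close>, of h "t - h"] h by auto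
  qed
qed

theorem corollary3p7:
  fixes adj :: "'v::finite \<Rightarrow> 'v \<Rightarrow> bool"
    and w :: "'v \<times> 'v \<Rightarrow> real"
    and F :: "'v \<times> 'v \<Rightarrow> real \<Rightarrow> real"
    and lam \<gamma> :: "'v \<Rightarrow> real"
    and P :: "('v \<Rightarrow> nat) \<Rightarrow> 'w measure"
    and X :: "real \<Rightarrow> 'w \<Rightarrow> ('v \<Rightarrow> nat)"
    and \<pi> :: "('v \<Rightarrow> nat) pmf"
    and \<alpha> :: real
  assumes model: "matching_model adj w F lam \<gamma>"
    and chain: "continuous_time_markov_chain (queue_states adj) (queue_generator adj w F lam \<gamma>) P X"
    and ncond: "lam \<in> Ncond adj \<gamma>"
    and invariant: "invariant_distribution (queue_states adj) P X \<pi>"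
    and alpha: "\<alpha> > 0"
    and drift: "\<exists>C'>0. \<exists>K>0. \<forall>x\<in>queue_states adj. euclidean_norm x \<ge> K \<longrightarrow>
      queue_generator adj w F lam \<gamma> (\<lambda>y. exp (\<alpha> * euclidean_norm y)) x
        \<le> - C' * exp (\<alpha> * euclidean_norm x)"
  shows "\<exists>C \<rho>. C > 0 \<and> 0 < \<rho> \<and> \<rho> < 1 \<and>
    (\<forall>x\<in>queue_states adj. \<forall>t\<ge>0.
      tv_dist (queue_states adj)
        (distr (P x) (count_space (queue_states adj)) (X t)) (measure_pmf \<pi>)
      \<le> C * \<rho> powr t * exp (\<alpha> * euclidean_norm x))"
proof -
  let ?S = "queue_states adj"
  let ?V = "\<lambda>y :: 'v \<Rightarrow> nat. exp (\<alpha> * euclidean_norm y)"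
  let ?L = "queue_generator adj w F lam \<gamma>"
  have countable: "countable ?S" by (rule countableI_type)
  interpret jump_semigroup ?S "transition_pmf P X" "queue_jumps adj"
    "queue_rate adj w F lam \<gamma>" queue_target
    using model chain by (rule jump_semigroup_queue)
  have gen: "gen f x = ?L f x" for f x
    by (simp add: gen_def queue_generator_jumps)
  obtain c K where c: "0 < c"
    and far: "\<And>x. x \<in> ?S \<Longrightarrow> K \<le> euclidean_norm x \<Longrightarrow> ?L ?V x \<le> - c * ?V x"
    using drift by blast
  \<comment> \<open>The ball holds finitely many states, so the largest excess of the generator over
    \<open>- c * ?V\<close> there is a finite \<open>b\<close>. This makes the drift inequality
    global; the inserted 0 keeps \<open>b\<close> nonnegative.\<close>
  define near where "near = (\<lambda>x. ?L ?V x + c * ?V x) ` {x. euclidean_norm x \<le> K}"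
  define b where "b = Max (insert 0 near)"
  have near: "finite near" unfolding near_def by (intro finite_imageI finite_norm_sublevel)
  then have b: "0 \<le> b" by (simp add: b_def)
  have drift': "gen ?V x \<le> - c * ?V x + b" if "x \<in> ?S" for x
  proof (cases "K \<le> euclidean_norm x")
    case True
    then show ?thesis using far[OF that] b by (simp add: gen)
  next
    case False
    then have "?L ?V x + c * ?V x \<in> near" by (auto simp: near_def)
    then have "?L ?V x + c * ?V x \<le> b" using near by (simp add: b_def)
    then show ?thesis by (simp add: gen)
  qed
  have empty: "(\<lambda>_. 0) \<in> ?S" by (simp add: queue_states_def)
  have sublevel: "finite {y \<in> ?S. ?V y \<le> m}" for m
    by (rule finite_subset[OF _ finite_exp_norm_sublevel[OF alpha, of m]]) auto
  have V_ge_1: "1 \<le> ?V y" for y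
    using alpha by (simp add: euclidean_norm_def L2_set_nonneg)
  have \<pi>: "set_pmf \<pi> \<subseteq> ?S" using invariant by (simp add: invariant_distribution_def)
  note \<pi>_bind = invariant_bind_transition_pmf[OF chain countable invariant]
  note reach = empty_queue_reachable[OF model ncond chain _ zero_less_one]
  obtain C \<rho> where "0 < C" "0 < \<rho>" "\<rho> < 1"
    and bound: "\<And>x t A. x \<in> ?S \<Longrightarrow> 0 \<le> t \<Longrightarrow>
      \<bar>measure_pmf.prob (transition_pmf P X t x) A - measure_pmf.prob \<pi> A\<bar> \<le> C * \<rho> powr t * ?V x"
    using exponential_ergodicity[OF sublevel V_ge_1 c b drift' \<pi> \<pi>_bind empty reach] by metis
  moreover have "tv_dist ?S (distr (P x) (count_space ?S) (X t)) (measure_pmf \<pi>)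
      \<le> C * \<rho> powr t * ?V x" if "x \<in> ?S" "0 \<le> t" for x t
    using bound[OF that] by (rule tv_dist_transition_pmf[OF chain countable that])
  ultimately show ?thesis by blast
qed

end
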